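(* Let $1\le p,q\le\infty$ and $s\in\mathbb{R}$, and let $u(t)=u(t;\omega)=\sum_{n\in\mathbb{Z}\setminus\{0\}}\frac{g_n(\omega)}{n}e^{int}$ be the mean-zero complex-valued periodic Brownian motion on $\mathbb{T}$, where $\{g_n\}_{n\neq 0}$ are independent standard complex-valued Gaussian random variables. Then: (a) If $q<\infty$, then $u\in M^{p,q}_s(\mathbb{T})$ almost surely when $(s-1)q<-1$, and $u\notin M^{p,q}_s(\mathbb{T})$ almost surely when $(s-1)q\ge -1$. (b) If $q=\infty$, then $u\in M^{p,\infty}_s(\mathbb{T})$ almost surely when $s<1$, and $u\notin M^{p,\infty}_s(\mathbb{T})$ almost surely when $s\ge 1$. (c) If $q<\infty$, then $u\in\widehat{b}^s_{p,q}(\mathbb{T})$ almost surely when $(s-1)p<-1$, and $u\notin\widehat{b}^s_{p,q}(\mathbb{T})$ almost surely when $(s-1)p\ge -1$. (For $p=\infty$, the condition $(s-1)p<-1$ is read as $s<1$ and $(s-1)p\ge-1$ as $s\ge 1$.) (d) If $q=\infty$ and $p<\infty$, then $u\in\widehat{b}^s_{p,\infty}(\mathbb{T})$ almost surely when $(s-1)p\le -1$, and $u\notin\widehat{b}^s_{p,\infty}(\mathbb{T})$ almost surely when $(s-1)p>-1$.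
   Context: $\mathbb{T}=\mathbb{R}/2\pi\mathbb{Z}$, $\langle n\rangle=(1+|n|^2)^{1/2}$, and $\widehat{u}(n)$, $n\in\mathbb{Z}$, denote Fourier coefficients; factors of $2\pi$ are ignored, so that $\widehat{u}(n)=g_n/n$ for $n\ne0$ and $\widehat u(0)=0$. "Standard complex-valued Gaussian" means that $\mathrm{Re}\,g_n$ and $\mathrm{Im}\,g_n$ are independent standard real-valued Gaussian random variables. Membership of $u$ in a space means that the corresponding norm is finite. Modulation space on the torus: $\|u\|_{M^{p,q}_s(\mathbb{T})}=\big\|\langle n\rangle^s\|\psi(D-n)u\|_{L^p_x(\mathbb{T})}\big\|_{\ell^q_n(\mathbb{Z})}$, where $\psi:\mathbb{Z}\to\mathbb{C}$ is finitely supported with $\sum_{n\in\mathbb{Z}}\psi(k-n)=1$ for all $k\in\mathbb{Z}$, and $\psi(D-n)u$ is the trigonometric polynomial with Fourier coefficients $\psi(k-n)\widehat{u}(k)$. For all $1\le p,q\le\infty$ this space coincides, with equivalent norms, with the Fourier-Lebesgue space $\mathcal{F}L^{s,q}(\mathbb{T})$ with norm $\|u\|_{\mathcal{F}L^{s,q}(\mathbb{T})}=\|\langle n\rangle^s\widehat{u}(n)\|_{\ell^q_n(\mathbb{Z})}$. Fourier-Besov space: let $\varphi_0,\varphi\in\mathcal{S}(\mathbb{R})$ with $\mathrm{supp}\,\varphi_0\subset\{|\xi|\le2\}$, $\mathrm{supp}\,\varphi\subset\{\frac12\le|\xi|\le2\}$, $\varphi_0(\xi)+\sum_{j\ge1}\varphi(2^{-j}\xi)\equiv1$,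 and $\varphi_j(\xi)=\varphi(2^{-j}\xi)$ for $j\ge1$. Then $\|u\|_{\widehat{b}^s_{p,q}(\mathbb{T})}=\big\|\,\|\langle n\rangle^s\varphi_j(n)\widehat{u}(n)\|_{\ell^p_n(\mathbb{Z})}\big\|_{\ell^q_j(\mathbb{Z}_{\ge0})}$. For mean-zero $u$ this is equivalent to $\big\|\,2^{js}\|\widehat{u}(n)\|_{\ell^p_{|n|\sim2^j}}\big\|_{\ell^q_j}$, where $|n|\sim2^j$ means $2^{j-1}<|n|\le2^j$. *)

theory Defs
  imports "HOL-Probability.Probability"
begin

section \<open>Lebesgue norms with an exponent in $[1,\infty]$\<close>

text \<open>Only used for \<open>r > 0\<close>, where \<open>0\<close> and \<open>\<infinity>\<close> are mapped to themselves.\<close>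
definition ennreal_powr :: "ennreal \<Rightarrow> real \<Rightarrow> ennreal" where
  "ennreal_powr x r = (if x = \<infinity> then \<infinity> else ennreal (enn2real x powr r))"

text \<open>Over \<open>count_space I\<close> this is the \<open>\<ell>\<^sup>p(I)\<close> norm: the only null set is empty, so
  the essential supremum is the supremum.\<close>
definition Lp_norm :: "ennreal \<Rightarrow> 'a measure \<Rightarrow> ('a \<Rightarrow> ennreal) \<Rightarrow> ennreal" where
  "Lp_norm p M f =
     (if p = \<infinity> then esssup M f
      else ennreal_powr (\<integral>\<^sup>+ x. ennreal_powr (f x) (enn2real p) \<partial>M) (1 / enn2real p))"

abbreviation lp_norm :: "ennreal \<Rightarrow> ('a \<Rightarrow> ennreal) \<Rightarrow> ennreal" where
  "lp_norm p f \<equiv> Lp_norm p (count_space UNIV) f"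

section \<open>Fourier series on the torus\<close>

text \<open>A function on \<open>\<real> / 2\<pi>\<int>\<close> is represented by a function on \<open>real\<close> of which only the values
  on \<open>[0, 2\<pi>]\<close> matter.\<close>
definition torus :: "real measure" where
  "torus = lebesgue_on {0..2 * pi}"

definition fourier_coeff :: "(real \<Rightarrow> complex) \<Rightarrow> int \<Rightarrow> complex" where
  "fourier_coeff f n = (LINT t|torus. f t * cis (- (of_int n * t))) / (2 * pi)"

text \<open>\<open>f\<close> is the sum of the Fourier series with coefficients \<open>c\<close>, convergence being in
  \<open>L\<^sup>2\<close> of the torus.\<close>
definition sum_of_fourier_series :: "(real \<Rightarrow> complex) \<Rightarrow> (int \<Rightarrow> complex) \<Rightarrow> bool" where
  "sum_of_fourier_series f c \<longleftrightarrow>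
     f \<in> borel_measurable torus \<and>
     (\<lambda>N::nat. Lp_norm 2 torus
        (\<lambda>t. ennreal (cmod (f t - (\<Sum>n\<in>{- int N..int N}. c n * cis (of_int n * t))))))
     \<longlonglongrightarrow> 0"

definition japanese_bracket :: "int \<Rightarrow> real" where
  "japanese_bracket n = (1 + \<bar>of_int n\<bar>\<^sup>2) powr (1 / 2)"

section \<open>Modulation and Fourier-Besov norms\<close>

text \<open>The norms are functions of the sequence \<open>c\<close> of Fourier coefficients, so that they apply to
  periodic distributions as well. A distribution belongs to the space iff its norm is finite.\<close>

definition modulation_window :: "(int \<Rightarrow> complex) \<Rightarrow> bool" where
  "modulation_window \<psi> \<longleftrightarrow>
     finite {k. \<psi> k \<noteq> 0} \<and> (\<forall>k. (\<Sum>\<^sub>\<infinity>n\<in>UNIV. \<psi> (k - n)) = 1)"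

text \<open>The trigonometric polynomial \<open>\<psi>(D - n)u\<close>, where \<open>c\<close> are the Fourier coefficients
  of \<open>u\<close>.\<close>
definition window_piece :: "(int \<Rightarrow> complex) \<Rightarrow> int \<Rightarrow> (int \<Rightarrow> complex) \<Rightarrow> real \<Rightarrow> complex" where
  "window_piece \<psi> n c x = (\<Sum>k | \<psi> (k - n) \<noteq> 0. \<psi> (k - n) * c k * cis (of_int k * x))"

definition modulation_norm ::
  "(int \<Rightarrow> complex) \<Rightarrow> ennreal \<Rightarrow> ennreal \<Rightarrow> real \<Rightarrow> (int \<Rightarrow> complex) \<Rightarrow> ennreal" where
  "modulation_norm \<psi> p q s c =
     lp_norm q (\<lambda>n. ennreal (japanese_bracket n powr s) *
                    Lp_norm p torus (\<lambda>x. ennreal (cmod (window_piece \<psi> n c x))))"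

text \<open>\<open>F k\<close> is the \<open>k\<close>-th derivative of \<open>f\<close>.\<close>
definition schwartz_function :: "(real \<Rightarrow> complex) \<Rightarrow> bool" where
  "schwartz_function f \<longleftrightarrow>
     (\<exists>F :: nat \<Rightarrow> real \<Rightarrow> complex.
        F 0 = f \<and>
        (\<forall>k x. (F k has_vector_derivative F (Suc k) x) (at x)) \<and>
        (\<forall>k m. bounded (range (\<lambda>x. x ^ m *\<^sub>R F k x))))"

definition dyadic_partition :: "(real \<Rightarrow> complex) \<Rightarrow> (real \<Rightarrow> complex) \<Rightarrow> bool" where
  "dyadic_partition \<phi>\<^sub>0 \<phi> \<longleftrightarrow>
     schwartz_function \<phi>\<^sub>0 \<and> schwartz_function \<phi> \<and>
     closure {\<xi>. \<phi>\<^sub>0 \<xi> \<noteq> 0} \<subseteq> {\<xi>. \<bar>\<xi>\<bar> \<le> 2} \<and>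
     closure {\<xi>. \<phi> \<xi> \<noteq> 0} \<subseteq> {\<xi>. 1 / 2 \<le> \<bar>\<xi>\<bar> \<and> \<bar>\<xi>\<bar> \<le> 2} \<and>
     (\<forall>\<xi>. \<phi>\<^sub>0 \<xi> + (\<Sum>\<^sub>\<infinity>j\<in>{1::nat..}. \<phi> (\<xi> / 2 ^ j)) = 1)"

definition dyadic_piece ::
  "(real \<Rightarrow> complex) \<Rightarrow> (real \<Rightarrow> complex) \<Rightarrow> nat \<Rightarrow> real \<Rightarrow> complex" where
  "dyadic_piece \<phi>\<^sub>0 \<phi> j \<xi> = (if j = 0 then \<phi>\<^sub>0 \<xi> else \<phi> (\<xi> / 2 ^ j))"

definition fourier_besov_norm ::
  "(real \<Rightarrow> complex) \<Rightarrow> (real \<Rightarrow> complex) \<Rightarrow> ennreal \<Rightarrow> ennreal \<Rightarrow> real \<Rightarrow>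
   (int \<Rightarrow> complex) \<Rightarrow> ennreal" where
  "fourier_besov_norm \<phi>\<^sub>0 \<phi> p q s c =
     lp_norm q (\<lambda>j. lp_norm p (\<lambda>n.
       ennreal (cmod (japanese_bracket n powr s * dyadic_piece \<phi>\<^sub>0 \<phi> j (of_int n) * c n))))"

section \<open>Complex Gaussian random variables\<close>

text \<open>Real and imaginary part each have variance 1, so the complex variable has variance 2.\<close>
definition standard_complex_gaussian :: "'w measure \<Rightarrow> ('w \<Rightarrow> complex) \<Rightarrow> bool" where
  "standard_complex_gaussian M X \<longleftrightarrow>
     distributed M lborel (\<lambda>\<omega>. Re (X \<omega>)) std_normal_density \<and>
     distributed M lborel (\<lambda>\<omega>. Im (X \<omega>)) std_normal_density \<and>
     prob_space.indep_var M borel (\<lambda>\<omega>. Re (X \<omega>)) borel (\<lambda>\<omega>. Im (X \<omega>))"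

end

theory Submission
  imports Defs
begin

text \<open>Almost surely \<open>u\<close> has the Fourier coefficients \<open>g\<^sub>n / n\<close>, and up to equivalence both norms only
  see the moduli
  \<open>x\<^sub>n = \<langle>n\<rangle>\<^sup>s |g\<^sub>n| / |n|\<close>. The modulation norm is equivalent to the \<open>\<ell>\<^sup>q\<close> norm of \<open>x\<close>, whatever \<open>p\<close> is,
  because each of its pieces has boundedly many frequencies
  (\<open>modulation_norm_less_top_iff\<close>). The Fourier-Besov norm is equivalent to the mixed norm that
  takes the \<open>\<ell>\<^sup>p\<close> norm of \<open>x\<close> on each dyadic block \<open>2\<^sup>k \<le> |n| < 2\<^sup>k\<^sup>+\<^sup>1\<close> and then the \<open>\<ell>\<^sup>q\<close> norm over the
  blocks (\<open>fourier_besov_norm_less_top_iff\<close>). Since \<open>\<ell>\<^sup>q\<close> is the mixed norm with \<open>p = q\<close>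
  (\<open>lp_norm_less_top_iff_block_norm\<close>), one dichotomy for mixed norms answers all four questions.

  For that dichotomy the randomness enters only through averages over blocks. For every
  \<open>0 \<le> r < \<infinity>\<close>, Chebyshev's inequality and the Borel-Cantelli lemma show that almost surely the sum of
  \<open>|g\<^sub>n|\<^sup>r\<close> over the \<open>k\<close>-th block is comparable to \<open>2\<^sup>k\<close> for all large \<open>k\<close>
  (\<open>AE_gaussian_moment_dyadic_block\<close>). Because \<open>x\<^sub>n\<close> is comparable to \<open>2\<^sup>k\<^sup>(\<^sup>s\<^sup>-\<^sup>1\<^sup>) |g\<^sub>n|\<close> on the
  block, the \<open>\<ell>\<^sup>p\<close> norm of \<open>x\<close> there is comparable to \<open>2\<close> to the power \<open>k (s - 1 + 1 / p)\<close> if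
  \<open>p < \<infinity>\<close>. A geometric sequence is in \<open>\<ell>\<^sup>q\<close> iff it decays or, for \<open>q = \<infinity>\<close>, is bounded, and the
  threshold \<open>(s - 1) p = -1\<close> follows, with equality allowed exactly when \<open>q = \<infinity>\<close>.

  For \<open>p = \<infinity>\<close> there is no comparison with a geometric sequence. If \<open>s < 1\<close>, the supremum over
  a block is at most the \<open>\<ell>\<^sup>r\<close> norm, and a large finite \<open>r\<close> still satisfies \<open>(s - 1) r < -1\<close>. If
  \<open>s \<ge> 1\<close>, the same block averages, applied to the indicator of \<open>|g\<^sub>n| > K\<close>, show that the
  suprema are almost surely unbounded (\<open>AE_gaussian_large_in_dyadic_block\<close>).\<close>

section \<open>Lebesgue norms\<close>

lemma ennreal_powr_ennreal: "0 \<le> x \<Longrightarrow> ennreal_powr (ennreal x) r = ennreal (x powr r)"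
  by (simp add: ennreal_powr_def)

lemma ennreal_powr_top [simp]: "ennreal_powr \<top> r = \<top>"
  by (simp add: ennreal_powr_def)

lemma ennreal_powr_zero [simp]: "ennreal_powr 0 r = 0"
  by (simp add: ennreal_powr_def)

lemma ennreal_powr_less_top_iff [simp]: "ennreal_powr x r < \<top> \<longleftrightarrow> x < \<top>"
  by (auto simp: ennreal_powr_def top.not_eq_extremum)

lemma ennreal_powr_eq_0_iff [simp]: "ennreal_powr x r = 0 \<longleftrightarrow> x = 0"
  by (cases x) (auto simp: ennreal_powr_ennreal)

lemma ennreal_powr_mono: "x \<le> y \<Longrightarrow> 0 \<le> r \<Longrightarrow> ennreal_powr x r \<le> ennreal_powr y r"
  by (cases x; cases y) (auto simp: ennreal_powr_ennreal powr_mono2 top_unique)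

lemma ennreal_powr_powr:
  "0 < r \<Longrightarrow> ennreal_powr (ennreal_powr x r) (1 / r) = x"
  "0 < r \<Longrightarrow> ennreal_powr (ennreal_powr x (1 / r)) r = x"
  by (cases x; simp add: ennreal_powr_ennreal powr_powr)+

lemma ennreal_powr_cmult:
  "0 \<le> c \<Longrightarrow> ennreal_powr (ennreal c * x) r = ennreal (c powr r) * ennreal_powr x r"
  by (cases x; cases "c = 0")
     (auto simp: ennreal_powr_ennreal ennreal_mult_top powr_mult simp flip: ennreal_mult)

lemma ennreal_powr_add_le:
  assumes "0 \<le> r"
  shows "ennreal_powr (x + y) r \<le> ennreal (2 powr r) * (ennreal_powr x r + ennreal_powr y r)"
proof -
  have "x + y \<le> 2 * max x y"
    unfolding mult_2 by (intro add_mono) auto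
  then have "ennreal_powr (x + y) r \<le> ennreal_powr (ennreal 2 * max x y) r"
    using assms by (intro ennreal_powr_mono) auto
  also have "\<dots> = ennreal (2 powr r) * ennreal_powr (max x y) r"
    by (rule ennreal_powr_cmult) simp
  also have "\<dots> \<le> ennreal (2 powr r) * (ennreal_powr x r + ennreal_powr y r)"
    by (intro mult_left_mono) (auto simp: max_def)
  finally show ?thesis .
qed

lemma borel_measurable_ennreal_powr [measurable (raw)]:
  "f \<in> borel_measurable M \<Longrightarrow> (\<lambda>x. ennreal_powr (f x) r) \<in> borel_measurable M"
proof -
  assume [measurable]: "f \<in> borel_measurable M"
  have "(\<lambda>x. if f x = \<infinity> then \<infinity> else ennreal (enn2real (f x) powr r)) \<in> borel_measurable M"
    by (rule measurable_If) measurable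
  then show ?thesis unfolding ennreal_powr_def .
qed

lemma exponent_cases:
  assumes "(1::ennreal) \<le> p"
  obtains (top) "p = \<infinity>" | (real) r where "1 \<le> r" "p = ennreal r"
  using assms by (cases p) auto

lemma Lp_norm_ennreal:
  "0 \<le> r \<Longrightarrow> Lp_norm (ennreal r) M f = ennreal_powr (\<integral>\<^sup>+ x. ennreal_powr (f x) r \<partial>M) (1 / r)"
  by (simp add: Lp_norm_def)

lemma Lp_norm_top: "Lp_norm \<infinity> M f = esssup M f" "Lp_norm \<top> M f = esssup M f"
  by (simp_all add: Lp_norm_def)

lemma Lp_norm_mono:
  assumes "1 \<le> p" "f \<in> borel_measurable M" "\<And>x. f x \<le> g x"
  shows "Lp_norm p M f \<le> Lp_norm p M g"
  using assms(1)
proof (cases p rule: exponent_cases)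
  case top
  then show ?thesis using assms by (simp add: Lp_norm_top esssup_mono)
next
  case (real r)
  then show ?thesis using assms
    by (auto simp: Lp_norm_ennreal intro!: ennreal_powr_mono nn_integral_mono)
qed

lemma Lp_norm_cmult_le:
  assumes "1 \<le> p" "0 \<le> c" and [measurable]: "f \<in> borel_measurable M"
  shows "Lp_norm p M (\<lambda>x. ennreal c * f x) \<le> ennreal c * Lp_norm p M f"
  using assms(1)
proof (cases p rule: exponent_cases)
  case top
  have "AE x in M. ennreal c * f x \<le> ennreal c * esssup M f"
    using esssup_AE[of f M] by eventually_elim (simp add: mult_left_mono)
  then show ?thesis by (simp add: top Lp_norm_top esssup_I)
next
  case (real r)
  then show ?thesis using assms
    by (simp add: Lp_norm_ennreal ennreal_powr_cmult nn_integral_cmult powr_powr)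
qed

text \<open>The constant is not the one of Minkowski's inequality, but it does not depend on the
  exponent: \<open>(x + y)\<^sup>r \<le> 2\<^sup>r (x\<^sup>r + y\<^sup>r)\<close> because \<open>x + y \<le> 2 max x y\<close>, and the same bound applies to
  the outer power \<open>1 / r \<le> 1\<close>.\<close>
lemma Lp_norm_add_le:
  assumes "1 \<le> p" and [measurable]: "f \<in> borel_measurable M" "g \<in> borel_measurable M"
  shows "Lp_norm p M (\<lambda>x. f x + g x) \<le> 4 * (Lp_norm p M f + Lp_norm p M g)"
  using assms(1)
proof (cases p rule: exponent_cases)
  case top
  have "AE x in M. f x + g x \<le> esssup M f + esssup M g"
    using esssup_AE[of f M] esssup_AE[of g M] by eventually_elim (rule add_mono)
  then have "esssup M (\<lambda>x. f x + g x) \<le> 1 * (esssup M f + esssup M g)"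
    by (simp add: esssup_I)
  also have "\<dots> \<le> 4 * (esssup M f + esssup M g)"
    by (intro mult_right_mono) auto
  finally show ?thesis by (simp add: top Lp_norm_top)
next
  case (real r)
  define A where "A = (\<integral>\<^sup>+ x. ennreal_powr (f x) r \<partial>M)"
  define B where "B = (\<integral>\<^sup>+ x. ennreal_powr (g x) r \<partial>M)"
  have "(\<integral>\<^sup>+ x. ennreal_powr (f x + g x) r \<partial>M)
      \<le> (\<integral>\<^sup>+ x. ennreal (2 powr r) * (ennreal_powr (f x) r + ennreal_powr (g x) r) \<partial>M)"
    using real by (intro nn_integral_mono ennreal_powr_add_le) auto
  also have "\<dots> = ennreal (2 powr r) * (A + B)"
    by (simp add: A_def B_def nn_integral_cmult nn_integral_add)
  finally have "Lp_norm p M (\<lambda>x. f x + g x) \<le> ennreal_powr (ennreal (2 powr r) * (A + B)) (1 / r)"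
    using real by (auto simp: Lp_norm_ennreal intro!: ennreal_powr_mono)
  also have "\<dots> = 2 * ennreal_powr (A + B) (1 / r)"
    using real by (simp add: ennreal_powr_cmult powr_powr)
  also have "\<dots> \<le> 2 * (ennreal (2 powr (1 / r)) * (ennreal_powr A (1 / r) + ennreal_powr B (1 / r)))"
    using real by (intro mult_left_mono ennreal_powr_add_le) auto
  also have "\<dots> \<le> 2 * (ennreal 2 * (ennreal_powr A (1 / r) + ennreal_powr B (1 / r)))"
    using real powr_mono[of "1 / r" 1 2] by (intro mult_left_mono mult_right_mono ennreal_leI) auto
  also have "\<dots> = 4 * (Lp_norm p M f + Lp_norm p M g)"
    using real by (simp add: Lp_norm_ennreal A_def B_def mult.assoc[symmetric])
  finally show ?thesis .
qed

lemma Lp_norm_zero: "1 \<le> p \<Longrightarrow> Lp_norm p M (\<lambda>x. 0) = 0"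
  using Lp_norm_cmult_le[of p 0 "\<lambda>x. 0" M] by (simp)

lemma Lp_norm_sum_less_top:
  assumes "1 \<le> p" "\<And>i. i \<in> I \<Longrightarrow> f i \<in> borel_measurable M"
    and "\<And>i. i \<in> I \<Longrightarrow> Lp_norm p M (f i) < \<top>"
  shows "Lp_norm p M (\<lambda>x. \<Sum>i\<in>I. f i x) < \<top>"
  using assms(2,3)
proof (induction I rule: infinite_finite_induct)
  case (insert i I)
  have "Lp_norm p M (\<lambda>x. f i x + (\<Sum>i\<in>I. f i x))
      \<le> 4 * (Lp_norm p M (f i) + Lp_norm p M (\<lambda>x. \<Sum>i\<in>I. f i x))"
    using insert assms(1) by (intro Lp_norm_add_le) auto
  also have "\<dots> < \<top>"
    using insert by (simp add: ennreal_mult_less_top)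
  finally show ?case using insert by simp
qed (use assms(1) in \<open>auto simp: Lp_norm_zero\<close>)

lemma Lp_norm_cmult_less_top:
  assumes "1 \<le> p" "0 \<le> c" "f \<in> borel_measurable M" "Lp_norm p M f < \<top>"
  shows "Lp_norm p M (\<lambda>x. ennreal c * f x) < \<top>"
  using Lp_norm_cmult_le[OF assms(1-3)] assms(4)
  by (auto simp: ennreal_mult_less_top intro: le_less_trans)

lemma Lp_norm_add3_le:
  assumes "1 \<le> p" "f \<in> borel_measurable M" "g \<in> borel_measurable M" "h \<in> borel_measurable M"
  shows "Lp_norm p M (\<lambda>x. f x + g x + h x) \<le> 16 * (Lp_norm p M f + Lp_norm p M g + Lp_norm p M h)"
proof -
  have "Lp_norm p M (\<lambda>x. f x + g x + h x) \<le> 4 * (Lp_norm p M (\<lambda>x. f x + g x) + Lp_norm p M h)"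
    using assms by (intro Lp_norm_add_le) auto
  also have "\<dots> \<le> 4 * (4 * (Lp_norm p M f + Lp_norm p M g) + 4 * Lp_norm p M h)"
  proof (intro mult_left_mono add_mono)
    show "Lp_norm p M h \<le> 4 * Lp_norm p M h"
      using mult_right_mono[of 1 4 "Lp_norm p M h"] by simp
    show "Lp_norm p M (\<lambda>x. f x + g x) \<le> 4 * (Lp_norm p M f + Lp_norm p M g)"
      using assms by (intro Lp_norm_add_le)
  qed auto
  also have "\<dots> = 16 * (Lp_norm p M f + Lp_norm p M g + Lp_norm p M h)"
    by (simp add: distrib_left mult.assoc[symmetric])
  finally show ?thesis .
qed

text \<open>On a finite measure space the \<open>L\<^sup>1\<close> norm is controlled by every other one. If \<open>0 < a < \<infinity>\<close> is the
  \<open>L\<^sup>r\<close> norm of \<open>f\<close>, then \<open>f \<le> a + a\<^sup>1\<^sup>-\<^sup>r f\<^sup>r\<close> (look separately at \<open>f \<le> a\<close> and at \<open>f > a\<close>), and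
  integration gives the bound without Hoelder's inequality.\<close>
lemma nn_integral_le_Lp_norm:
  assumes "1 \<le> p" and [measurable]: "f \<in> borel_measurable M"
  shows "(\<integral>\<^sup>+ x. f x \<partial>M) \<le> (emeasure M (space M) + 1) * Lp_norm p M f"
  using assms(1)
proof (cases p rule: exponent_cases)
  case top
  have "(\<integral>\<^sup>+ x. f x \<partial>M) \<le> (\<integral>\<^sup>+ x. esssup M f \<partial>M)"
    by (intro nn_integral_mono_AE esssup_AE)
  also have "\<dots> \<le> (emeasure M (space M) + 1) * Lp_norm p M f"
    by (simp add: top Lp_norm_top mult.commute mult_left_mono)
  finally show ?thesis .
next
  case (real r)
  define I where "I = (\<integral>\<^sup>+ x. ennreal_powr (f x) r \<partial>M)"
  have norm: "Lp_norm p M f = ennreal_powr I (1 / r)"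
    using real by (simp add: Lp_norm_ennreal I_def)
  show ?thesis
  proof (cases "Lp_norm p M f")
    case top
    then show ?thesis by (simp add: ennreal_mult_top)
  next
    case (real a)
    show ?thesis
    proof (cases "a = 0")
      case True
      then have "I = 0" using norm real by simp
      then have "AE x in M. f x = 0"
        by (simp add: I_def nn_integral_0_iff_AE)
      then have "(\<integral>\<^sup>+ x. f x \<partial>M) = 0" by (simp add: nn_integral_0_iff_AE)
      then show ?thesis by simp
    next
      case False
      with real have a: "0 < a" by simp
      have "I = ennreal_powr (ennreal a) r"
        using \<open>1 \<le> r\<close> norm real ennreal_powr_powr(2)[of r I] by simp
      then have I: "I = ennreal (a powr r)"
        using a by (simp add: ennreal_powr_ennreal)
      have pointwise: "f x \<le> ennreal a + ennreal (a powr (1 - r)) * ennreal_powr (f x) r" for x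
      proof (cases "f x")
        case (real y)
        have "y \<le> a + a powr (1 - r) * y powr r"
        proof (cases "y \<le> a")
          case True
          then show ?thesis using a by (simp add: add_increasing2)
        next
          case False
          have "y = y powr (1 - r) * y powr r"
            using False a by (simp flip: powr_add)
          also have "\<dots> \<le> a powr (1 - r) * y powr r"
            using False a \<open>1 \<le> r\<close> by (intro mult_right_mono powr_mono2') auto
          finally show ?thesis using a by linarith
        qed
        then show ?thesis using real a
          by (simp add: ennreal_powr_ennreal flip: ennreal_mult ennreal_plus)
      qed (use a in \<open>simp add: ennreal_mult_top\<close>)
      have "(\<integral>\<^sup>+ x. f x \<partial>M)
          \<le> (\<integral>\<^sup>+ x. ennreal a + ennreal (a powr (1 - r)) * ennreal_powr (f x) r \<partial>M)"
        by (intro nn_integral_mono pointwise)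
      also have "\<dots> = ennreal a * emeasure M (space M) + ennreal (a powr (1 - r)) * I"
        by (simp add: I_def nn_integral_add nn_integral_cmult)
      also have "ennreal (a powr (1 - r)) * I = ennreal a"
        using a by (simp add: I flip: ennreal_mult powr_add)
      finally show ?thesis by (simp add: real distrib_left mult.commute)
    qed
  qed
qed

lemma Lp_norm_less_top_iff:
  "1 \<le> r \<Longrightarrow> Lp_norm (ennreal r) M f < \<top> \<longleftrightarrow> (\<integral>\<^sup>+ x. ennreal_powr (f x) r \<partial>M) < \<top>"
  by (simp add: Lp_norm_ennreal)

section \<open>Sequence norms\<close>

lemma lp_norm_top_le_iff: "lp_norm \<infinity> f \<le> c \<longleftrightarrow> (\<forall>x. f x \<le> c)"
  using esssup_AE[of f "count_space UNIV"]
  by (auto simp: Lp_norm_top AE_count_space intro!: esssup_I intro: order_trans)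

lemma le_lp_norm:
  assumes "1 \<le> p"
  shows "f x \<le> lp_norm p f"
  using assms
proof (cases p rule: exponent_cases)
  case top
  then show ?thesis using lp_norm_top_le_iff[of f] by blast
next
  case (real r)
  have "ennreal_powr (f x) r \<le> (\<integral>\<^sup>+ x. ennreal_powr (f x) r \<partial>count_space UNIV)"
    using nn_integral_ge_point[of x UNIV "\<lambda>x. ennreal_powr (f x) r"] by simp
  then have "ennreal_powr (ennreal_powr (f x) r) (1 / r) \<le> lp_norm p f"
    using real by (auto simp: Lp_norm_ennreal intro!: ennreal_powr_mono)
  then show ?thesis using real by (simp add: ennreal_powr_powr)
qed

lemma lp_norm_top_le_lp_norm: "1 \<le> p \<Longrightarrow> lp_norm \<infinity> f \<le> lp_norm p f"
  unfolding lp_norm_top_le_iff by (simp add: le_lp_norm)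

lemma lp_norm_top_less_top: "(\<And>x. f x \<le> c) \<Longrightarrow> c < \<top> \<Longrightarrow> lp_norm \<infinity> f < \<top>"
  using lp_norm_top_le_iff[of f c] le_less_trans by blast

lemma lp_norm_reindex:
  assumes "1 \<le> p" "bij h"
  shows "lp_norm p (\<lambda>x. f (h x)) = lp_norm p f"
  using assms(1)
proof (cases p rule: exponent_cases)
  case top
  have "lp_norm \<infinity> (\<lambda>x. f (h x)) \<le> c \<longleftrightarrow> lp_norm \<infinity> f \<le> c" for c
    unfolding lp_norm_top_le_iff using bij_pointE[OF assms(2)] by metis
  then show ?thesis unfolding top by (intro antisym) auto
next
  case (real r)
  then show ?thesis
    using nn_integral_bij_count_space[of h UNIV UNIV "\<lambda>x. ennreal_powr (f x) r"] assms
    by (simp add: Lp_norm_ennreal)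
qed

lemma lp_norm_finite_support_less_top:
  assumes "1 \<le> p" "finite A" "\<And>x. x \<notin> A \<Longrightarrow> f x = 0" "\<And>x. f x < \<top>"
  shows "lp_norm p f < \<top>"
  using assms(1)
proof (cases p rule: exponent_cases)
  case top
  have "f x \<le> sum f A" for x
    by (cases "x \<in> A") (use assms in \<open>auto intro: member_le_sum\<close>)
  then show ?thesis unfolding top using assms by (intro lp_norm_top_less_top) (auto simp: less_top)
next
  case (real r)
  have "(\<integral>\<^sup>+ x. ennreal_powr (f x) r \<partial>count_space UNIV) = (\<Sum>x\<in>A. ennreal_powr (f x) r)"
    using assms by (intro nn_integral_count_space') auto
  then show ?thesis using real assms by (simp add: Lp_norm_less_top_iff)
qed

lemma lp_norm_Suc_less_top_iff:
  assumes "1 \<le> p"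
  shows "lp_norm p f < \<top> \<longleftrightarrow> f 0 < \<top> \<and> lp_norm p (\<lambda>k. f (Suc k)) < \<top>"
  using assms
proof (cases p rule: exponent_cases)
  case top
  show ?thesis unfolding top
  proof safe
    assume f: "lp_norm \<infinity> f < \<top>"
    show "f 0 < \<top>" using f le_lp_norm[of \<infinity> f 0] by (auto intro: le_less_trans)
    show "lp_norm \<infinity> (\<lambda>k. f (Suc k)) < \<top>"
      by (rule lp_norm_top_less_top[OF _ f]) (simp add: le_lp_norm)
  next
    assume f: "f 0 < \<top>" "lp_norm \<infinity> (\<lambda>k. f (Suc k)) < \<top>"
    show "lp_norm \<infinity> f < \<top>"
    proof (rule lp_norm_top_less_top)
      show "f k \<le> f 0 + lp_norm \<infinity> (\<lambda>k. f (Suc k))" for k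
        by (cases k) (auto intro: add_increasing le_lp_norm[of \<infinity> "\<lambda>k. f (Suc k)", simplified])
    qed (use f in simp)
  qed
next
  case (real r)
  have "(\<Sum>k. ennreal_powr (f k) r) = ennreal_powr (f 0) r + (\<Sum>k. ennreal_powr (f (Suc k)) r)"
    using suminf_offset[of "\<lambda>k. ennreal_powr (f k) r" 1] by (simp add: summableI)
  then show ?thesis
    using real by (simp add: Lp_norm_less_top_iff nn_integral_count_space_nat)
qed

lemma lp_norm_shift_less_top_iff:
  fixes f :: "nat \<Rightarrow> ennreal"
  assumes "1 \<le> p"
  shows "lp_norm p f < \<top> \<longleftrightarrow> (\<forall>i<m. f i < \<top>) \<and> lp_norm p (\<lambda>k. f (k + m)) < \<top>"
proof (induction m)
  case (Suc m)
  show ?case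
    unfolding Suc using lp_norm_Suc_less_top_iff[OF assms, of "\<lambda>k. f (k + m)"]
    by (auto simp: less_Suc_eq)
qed simp

text \<open>Almost sure statements only control the tail of a random sequence, from a random index on.\<close>
lemma lp_norm_less_top_eventually_le:
  fixes f h :: "nat \<Rightarrow> ennreal"
  assumes "1 \<le> p" "\<And>k. f k < \<top>" "lp_norm p h < \<top>" "0 \<le> C"
    and ev: "eventually (\<lambda>k. f k \<le> ennreal C * h k) sequentially"
  shows "lp_norm p f < \<top>"
proof -
  obtain m where m: "\<And>k. k \<ge> m \<Longrightarrow> f k \<le> ennreal C * h k"
    using ev by (auto simp: eventually_sequentially)
  have "lp_norm p (\<lambda>k. f (k + m)) \<le> lp_norm p (\<lambda>k. ennreal C * h (k + m))"
    using assms m by (intro Lp_norm_mono) auto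
  also have "\<dots> \<le> ennreal C * lp_norm p (\<lambda>k. h (k + m))"
    using assms by (intro Lp_norm_cmult_le) auto
  also have "\<dots> < \<top>"
    using assms lp_norm_shift_less_top_iff[of p h m] by (auto simp: ennreal_mult_less_top)
  finally show ?thesis
    using assms lp_norm_shift_less_top_iff[of p f m] by auto
qed

text \<open>This is where the strict and the non-strict thresholds of finite and infinite outer exponents
  come from.\<close>
lemma lp_norm_geometric_less_top_iff:
  assumes "1 \<le> p"
  shows "lp_norm p (\<lambda>k::nat. ennreal (2 powr (real k * \<theta>))) < \<top> \<longleftrightarrow>
      (if p = \<infinity> then \<theta> \<le> 0 else \<theta> < 0)"
  using assms
proof (cases p rule: exponent_cases)
  case top
  show ?thesis
  proof (cases "\<theta> \<le> 0")
    case True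
    then have "ennreal (2 powr (real k * \<theta>)) \<le> 1" for k
      using powr_mono[of "real k * \<theta>" 0 2] by (simp add: mult_nonneg_nonpos)
    then have "lp_norm \<infinity> (\<lambda>k::nat. ennreal (2 powr (real k * \<theta>))) < \<top>"
      by (rule lp_norm_top_less_top) simp
    then show ?thesis unfolding top using True by simp
  next
    case False
    define N where "N = lp_norm \<infinity> (\<lambda>k::nat. ennreal (2 powr (real k * \<theta>)))"
    have "N = \<top>"
    proof (rule ccontr)
      assume "N \<noteq> \<top>"
      then obtain B where B: "N = ennreal B" "0 \<le> B" by (cases N) auto
      have le: "2 powr (real k * \<theta>) \<le> B" for k
      proof -
        have "ennreal (2 powr (real k * \<theta>)) \<le> ennreal B"
          unfolding B(1)[symmetric] N_def by (rule le_lp_norm) simp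
        then show ?thesis using B(2) by simp
      qed
      obtain k where "B < (2 powr \<theta>) ^ k"
        using real_arch_pow[of "2 powr \<theta>" B] False by auto
      then show False
        using le[of k] by (simp add: powr_powr mult.commute flip: powr_realpow)
    qed
    then show ?thesis unfolding top N_def[symmetric] using False by simp
  qed
next
  case (real r)
  have powr: "2 powr (real k * \<theta> * r) = (2 powr (\<theta> * r)) ^ k" for k :: nat
    by (simp add: powr_powr mult_ac flip: powr_realpow)
  have "lp_norm p (\<lambda>k::nat. ennreal (2 powr (real k * \<theta>))) < \<top>
      \<longleftrightarrow> (\<Sum>k. ennreal ((2 powr (\<theta> * r)) ^ k)) < \<top>"
    using real
    by (simp add: Lp_norm_less_top_iff ennreal_powr_ennreal nn_integral_count_space_nat powr_powr powr)
  also have "\<dots> \<longleftrightarrow> summable (\<lambda>k. (2 powr (\<theta> * r)) ^ k)"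
    unfolding less_top[symmetric]
    by (rule iffI, erule summable_suminf_not_top[rotated], simp, erule ennreal_suminf_neq_top, simp)
  also have "\<dots> \<longleftrightarrow> 2 powr (\<theta> * r) < 1"
    by (simp add: summable_geometric_iff)
  also have "\<dots> \<longleftrightarrow> \<theta> < 0"
    using real powr_less_cancel_iff[of 2 "\<theta> * r" 0] by (simp add: mult_less_0_iff)
  finally show ?thesis using real by simp
qed

lemma lp_norm_add3_less_top:
  assumes "1 \<le> q" "lp_norm q f < \<top>" "lp_norm q g < \<top>" "lp_norm q h < \<top>"
  shows "lp_norm q (\<lambda>x. f x + g x + h x) < \<top>"
  using Lp_norm_add3_le[OF assms(1), of f "count_space UNIV" g h] assms
  by (auto simp: ennreal_mult_less_top intro: le_less_trans)

section \<open>Fourier coefficients on the torus\<close>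

lemma emeasure_torus: "emeasure torus (space torus) = ennreal (2 * pi)"
  by (simp add: torus_def emeasure_restrict_space)

lemma finite_measure_torus: "finite_measure torus"
  by (rule finite_measureI) (simp add: emeasure_torus)

lemma Lp_norm_one_torus_less_top:
  assumes "1 \<le> p"
  shows "Lp_norm p torus (\<lambda>x. 1) < \<top>"
  using assms
proof (cases p rule: exponent_cases)
  case top
  have "esssup torus (\<lambda>x. 1 :: ennreal) \<le> 1"
    by (rule esssup_I) auto
  also have "1 < (\<top> :: ennreal)" by simp
  finally show ?thesis by (simp add: top Lp_norm_top)
next
  case (real r)
  then show ?thesis
    using ennreal_powr_ennreal[of 1 r] by (simp add: Lp_norm_less_top_iff emeasure_torus)
qed

lemma borel_measurable_torus_continuous:
  "continuous_on UNIV f \<Longrightarrow> (f :: real \<Rightarrow> complex) \<in> borel_measurable torus"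
  unfolding torus_def
  by (intro measurable_restrict_space1) (simp add: borel_measurable_continuous_onI measurable_completion)

lemma borel_measurable_torus_cis [measurable]:
  "(\<lambda>t. cis (of_int k * t)) \<in> borel_measurable torus"
  "(\<lambda>t. cis (- (of_int k * t))) \<in> borel_measurable torus"
  by (intro borel_measurable_torus_continuous continuous_intros)+

lemma integrable_torus_cis: "integrable torus (\<lambda>t. cis (of_int k * t))"
  by (rule finite_measure.integrable_const_bound[OF finite_measure_torus, of _ 1]) auto

lemma integral_torus_cis:
  "(LINT t|torus. cis (of_int k * t)) = (if k = 0 then complex_of_real (2 * pi) else 0)"
proof (cases "k = 0")
  case True
  then show ?thesis
    using emeasure_torus by (simp add: measure_def scaleR_conv_of_real)
next
  case False
  define F where "F t = cis (of_int k * t) / (\<i> * of_int k)" for t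
  have "((\<lambda>t. cis (of_int k * t)) has_integral (F (2 * pi) - F 0)) {0..2 * pi}"
  proof (rule fundamental_theorem_of_calculus)
    fix t :: real
    have "((\<lambda>t. exp (\<i> * of_int k * t) / (\<i> * of_int k)) has_field_derivative
        exp (\<i> * of_int k * t)) (at (of_real t))"
      using False by (auto intro!: derivative_eq_intros)
    then have "((\<lambda>t. exp (\<i> * of_int k * of_real t) / (\<i> * of_int k)) has_vector_derivative
        exp (\<i> * of_int k * of_real t)) (at t within {0..2 * pi})"
      by (rule has_vector_derivative_real_field)
    then show "(F has_vector_derivative cis (of_int k * t)) (at t within {0..2 * pi})"
      by (simp add: F_def[abs_def] cis_conv_exp mult_ac)
  qed simp
  moreover have "F (2 * pi) = F 0"
    using cis_multiple_2pi[of "of_int k"] by (simp add: F_def mult_ac)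
  ultimately have "((\<lambda>t. cis (of_int k * t)) has_integral 0) {0..2 * pi}"
    by simp
  moreover have "(LINT t|torus. cis (of_int k * t)) = integral {0..2 * pi} (\<lambda>t. cis (of_int k * t))"
    unfolding torus_def
    by (rule lebesgue_integral_eq_integral) (use integrable_torus_cis in \<open>simp_all add: torus_def\<close>)
  ultimately show ?thesis using False by (simp add: integral_unique)
qed

lemma fourier_coeff_trigonometric_polynomial:
  assumes "finite F"
  shows "fourier_coeff (\<lambda>t. \<Sum>k\<in>F. a k * cis (of_int k * t)) l = (if l \<in> F then a l else 0)"
proof -
  have "(LINT t|torus. (\<Sum>k\<in>F. a k * cis (of_int k * t)) * cis (- (of_int l * t)))
      = (LINT t|torus. (\<Sum>k\<in>F. a k * cis (of_int (k - l) * t)))"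
    by (intro Bochner_Integration.integral_cong)
       (auto simp: sum_distrib_right mult.assoc cis_mult left_diff_distrib)
  also have "\<dots> = (\<Sum>k\<in>F. LINT t|torus. a k * cis (of_int (k - l) * t))"
    by (intro Bochner_Integration.integral_sum integrable_mult_right integrable_torus_cis)
  also have "\<dots> = (\<Sum>k\<in>F. if k = l then a l * complex_of_real (2 * pi) else 0)"
    by (intro sum.cong refl) (simp add: integral_torus_cis del: of_int_diff)
  finally show ?thesis using assms by (simp add: fourier_coeff_def)
qed

lemma norm_fourier_coeff_le_Lp_norm:
  assumes "1 \<le> p" and [measurable]: "f \<in> borel_measurable torus"
  shows "ennreal (cmod (fourier_coeff f n))
      \<le> ennreal (2 * pi + 1) * Lp_norm p torus (\<lambda>t. ennreal (cmod (f t)))"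
proof -
  have "cmod (fourier_coeff f n) \<le> cmod (LINT t|torus. f t * cis (- (of_int n * t)))"
    using pi_gt3 by (simp add: fourier_coeff_def norm_divide divide_le_eq mult_le_cancel_left1)
  then have "ennreal (cmod (fourier_coeff f n)) \<le> ennreal (cmod (LINT t|torus. f t * cis (- (of_int n * t))))"
    by (rule ennreal_leI)
  also have "\<dots> \<le> (\<integral>\<^sup>+ t. ennreal (cmod (f t)) \<partial>torus)"
  proof (cases "integrable torus (\<lambda>t. f t * cis (- (of_int n * t)))")
    case True
    then show ?thesis
      using integral_norm_bound_ennreal[OF True] by (simp add: norm_mult)
  qed (simp add: not_integrable_integral_eq)
  also have "\<dots> \<le> (emeasure torus (space torus) + 1) * Lp_norm p torus (\<lambda>t. ennreal (cmod (f t)))"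
    using assms by (intro nn_integral_le_Lp_norm) auto
  finally show ?thesis by (simp add: emeasure_torus flip: ennreal_plus ennreal_1)
qed

text \<open>The Fourier coefficients depend continuously on the function in \<open>L\<^sup>2\<close>, and those of the
  partial sums are known by orthogonality.\<close>
lemma fourier_coeff_sum_of_fourier_series:
  assumes "sum_of_fourier_series f c"
  shows "fourier_coeff f = c"
proof
  fix n
  define S where "S N t = (\<Sum>k\<in>{- int N..int N}. c k * cis (of_int k * t))" for N t
  define \<epsilon> where "\<epsilon> N = Lp_norm 2 torus (\<lambda>t. ennreal (cmod (f t - S N t)))" for N
  have [measurable]: "f \<in> borel_measurable torus" and lim: "\<epsilon> \<longlonglongrightarrow> 0"
    using assms by (auto simp: sum_of_fourier_series_def \<epsilon>_def[abs_def] S_def)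
  have [measurable]: "S N \<in> borel_measurable torus" for N
    unfolding S_def[abs_def] by measurable
  have S_integrable: "integrable torus (S N)" for N
    unfolding S_def by (intro Bochner_Integration.integrable_sum integrable_mult_right integrable_torus_cis)
  have "eventually (\<lambda>N. \<epsilon> N < 1) sequentially"
    using lim by (rule order_tendstoD) simp
  then obtain N where N: "\<epsilon> N < 1" by (auto simp: eventually_sequentially)
  have "integrable torus (\<lambda>t. f t - S N t)"
    unfolding integrable_iff_bounded
  proof
    have "(\<integral>\<^sup>+ t. ennreal (cmod (f t - S N t)) \<partial>torus) \<le> (emeasure torus (space torus) + 1) * \<epsilon> N"
      unfolding \<epsilon>_def by (rule nn_integral_le_Lp_norm) auto
    also have "\<dots> < \<top>"
      using N by (auto simp: emeasure_torus ennreal_mult_less_top intro: less_trans)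
    finally show "(\<integral>\<^sup>+ t. ennreal (norm (f t - S N t)) \<partial>torus) < \<infinity>" by simp
  qed measurable
  from Bochner_Integration.integrable_add[OF this S_integrable[of N]]
  have f_integrable: "integrable torus f" by simp
  have times_cis: "integrable torus (\<lambda>t. h t * cis (- (of_int n * t)))"
    if "integrable torus h" for h :: "real \<Rightarrow> complex"
    using that
    by (rule Bochner_Integration.integrable_bound) (use that in \<open>auto simp: norm_mult\<close>)
  have bound: "ennreal (cmod (fourier_coeff f n - c n)) \<le> ennreal (2 * pi + 1) * \<epsilon> N"
    if "nat \<bar>n\<bar> \<le> N" for N
  proof -
    have "c n = fourier_coeff (S N) n"
      using that by (auto simp: S_def[abs_def] fourier_coeff_trigonometric_polynomial)
    then have "fourier_coeff f n - c n = fourier_coeff (\<lambda>t. f t - S N t) n"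
      using times_cis[OF f_integrable] times_cis[OF S_integrable[of N]]
      by (simp add: fourier_coeff_def diff_divide_distrib left_diff_distrib)
    moreover have "ennreal (cmod (fourier_coeff (\<lambda>t. f t - S N t) n)) \<le> ennreal (2 * pi + 1) * \<epsilon> N"
      unfolding \<epsilon>_def by (rule norm_fourier_coeff_le_Lp_norm) auto
    ultimately show ?thesis by metis
  qed
  have "(\<lambda>N. ennreal (2 * pi + 1) * \<epsilon> N) \<longlonglongrightarrow> ennreal (2 * pi + 1) * 0"
    by (intro ennreal_tendsto_cmult lim) simp
  moreover have "eventually (\<lambda>N. ennreal (cmod (fourier_coeff f n - c n)) \<le> ennreal (2 * pi + 1) * \<epsilon> N) sequentially"
    using eventually_ge_at_top[of "nat \<bar>n\<bar>"] by eventually_elim (rule bound)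
  ultimately have "ennreal (cmod (fourier_coeff f n - c n)) \<le> ennreal (2 * pi + 1) * 0"
    by (rule tendsto_lowerbound) simp
  then show "fourier_coeff f n = c n" by simp
qed

section \<open>The weight\<close>

text \<open>One bound for both signs of the exponent: the comparison is used in the direction in which
  the power is monotone.\<close>
lemma powr_le_powr_of_comparable:
  fixes a b C s :: real
  assumes "0 < a" "0 < b" "1 \<le> C" "a \<le> C * b" "b \<le> C * a"
  shows "a powr s \<le> C powr \<bar>s\<bar> * b powr s"
proof (cases "0 \<le> s")
  case True
  then show ?thesis
    using powr_mono2[of s a "C * b"] assms by (simp add: powr_mult)
next
  case False
  have "(C * a) powr s \<le> b powr s"
    using powr_mono2'[of s b "C * a"] assms False by simp
  then have "C powr (- s) * (C powr s * a powr s) \<le> C powr (- s) * b powr s"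
    using assms by (intro mult_left_mono) (simp_all add: powr_mult)
  then show ?thesis using assms False by (simp add: mult.assoc[symmetric] flip: powr_add)
qed

lemma japanese_bracket_ge:
  "1 \<le> japanese_bracket n" "\<bar>of_int n\<bar> \<le> japanese_bracket n"
  and japanese_bracket_le: "japanese_bracket n \<le> 1 + \<bar>of_int n\<bar>"
proof -
  have sqrt: "japanese_bracket n = sqrt (1 + \<bar>of_int n\<bar>\<^sup>2)"
    unfolding japanese_bracket_def by (rule powr_half_sqrt) simp
  show "1 \<le> japanese_bracket n" "\<bar>of_int n\<bar> \<le> japanese_bracket n"
    unfolding sqrt by (auto intro: real_le_rsqrt)
  show "japanese_bracket n \<le> 1 + \<bar>of_int n\<bar>"
    unfolding sqrt by (rule real_le_lsqrt) (auto simp: power2_sum)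
qed

text \<open>Peetre's inequality: translating the frequency by a bounded amount changes the weight by a
  bounded factor.\<close>
lemma japanese_bracket_shift:
  "japanese_bracket (n + m) \<le> 2 * (1 + \<bar>of_int m\<bar>) * japanese_bracket n"
proof -
  have "japanese_bracket (n + m) \<le> 1 + \<bar>real_of_int n\<bar> + \<bar>real_of_int m\<bar>"
    using japanese_bracket_le[of "n + m"] by simp
  also have "\<dots> \<le> (1 + \<bar>real_of_int m\<bar>) * (1 + \<bar>real_of_int n\<bar>)"
    by (simp add: algebra_simps)
  also have "\<dots> \<le> (1 + \<bar>real_of_int m\<bar>) * (2 * japanese_bracket n)"
    using japanese_bracket_ge[of n] by (intro mult_left_mono) auto
  finally show ?thesis by (simp add: mult_ac)
qed

lemma japanese_bracket_powr_shift:
  "japanese_bracket n powr s \<le> (2 * (1 + \<bar>of_int m\<bar>)) powr \<bar>s\<bar> * japanese_bracket (n + m) powr s"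
  "japanese_bracket (n + m) powr s \<le> (2 * (1 + \<bar>of_int m\<bar>)) powr \<bar>s\<bar> * japanese_bracket n powr s"
  using japanese_bracket_ge(1)[of n] japanese_bracket_ge(1)[of "n + m"]
    japanese_bracket_shift[of n m] japanese_bracket_shift[of "n + m" "- m"]
  by (intro powr_le_powr_of_comparable; simp)+

definition weighted_modulus :: "real \<Rightarrow> (int \<Rightarrow> complex) \<Rightarrow> int \<Rightarrow> real" where
  "weighted_modulus s c n = japanese_bracket n powr s * cmod (c n)"

lemma weighted_modulus_nonneg [simp]: "0 \<le> weighted_modulus s c n"
  by (simp add: weighted_modulus_def)

section \<open>Modulation norms are weighted sequence norms\<close>

lemma window_piece_eq:
  "window_piece \<psi> n c x = (\<Sum>m | \<psi> m \<noteq> 0. \<psi> m * c (n + m) * cis (of_int (n + m) * x))"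
proof -
  have "{k. \<psi> (k - n) \<noteq> 0} = (\<lambda>m. n + m) ` {m. \<psi> m \<noteq> 0}"
    by (auto simp: image_iff intro!: exI[of _ "_ - n"])
  then show ?thesis
    by (simp add: window_piece_def sum.reindex)
qed

lemma borel_measurable_window_piece [measurable]:
  "window_piece \<psi> n c \<in> borel_measurable torus"
  unfolding window_piece_def[abs_def] by measurable

text \<open>On the torus a frequency-localised piece has at most as many Fourier coefficients as the
  window has points. Its \<open>L\<^sup>p\<close> norm is bounded by the sum of their moduli and, each coefficient
  being an integral of the piece, it dominates each of them.\<close>
lemma modulation_norm_less_top_iff:
  assumes "modulation_window \<psi>" "1 \<le> p" "1 \<le> q"
  shows "modulation_norm \<psi> p q s c < \<top> \<longleftrightarrow> lp_norm q (\<lambda>n. ennreal (weighted_modulus s c n)) < \<top>"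
proof
  define K where "K = {m. \<psi> m \<noteq> 0}"
  have "finite K"
    using assms by (simp add: modulation_window_def K_def)
  have bij: "bij (\<lambda>n::int. n + m)" for m
    by (rule bij_betw_byWitness[of _ "\<lambda>n. n - m"]) auto
  define e where "e n = Lp_norm p torus (\<lambda>x. ennreal (cmod (window_piece \<psi> n c x)))" for n
  define L where "L m = (2 * (1 + \<bar>of_int m\<bar>)) powr \<bar>s\<bar>" for m :: int
  have L: "0 \<le> L m" for m by (simp add: L_def)
  have norm: "modulation_norm \<psi> p q s c = lp_norm q (\<lambda>n. ennreal (japanese_bracket n powr s) * e n)"
    by (simp add: modulation_norm_def e_def)
  show "modulation_norm \<psi> p q s c < \<top>"
    if fin: "lp_norm q (\<lambda>n. ennreal (weighted_modulus s c n)) < \<top>"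
  proof -
    obtain B where B: "0 \<le> B" "Lp_norm p torus (\<lambda>x. 1) = ennreal B"
      using Lp_norm_one_torus_less_top[OF assms(2)] by (cases "Lp_norm p torus (\<lambda>x. 1)") auto
    have piece: "ennreal (japanese_bracket n powr s) * e n
        \<le> (\<Sum>m\<in>K. ennreal (B * cmod (\<psi> m) * L m) * ennreal (weighted_modulus s c (n + m)))" for n
    proof -
      define S where "S = (\<Sum>m\<in>K. cmod (\<psi> m) * cmod (c (n + m)))"
      have "0 \<le> S" by (simp add: S_def sum_nonneg)
      have "cmod (window_piece \<psi> n c x) \<le> S" for x
        unfolding window_piece_eq K_def[symmetric] S_def
        by (rule sum_norm_le) (simp add: norm_mult)
      then have "e n \<le> Lp_norm p torus (\<lambda>x. ennreal S * 1)"
        unfolding e_def using assms by (intro Lp_norm_mono) (auto intro: ennreal_leI)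
      also have "\<dots> \<le> ennreal S * ennreal B"
        using Lp_norm_cmult_le[OF assms(2) \<open>0 \<le> S\<close>, of "\<lambda>x. 1" torus] B by simp
      finally have "ennreal (japanese_bracket n powr s) * e n
          \<le> ennreal (japanese_bracket n powr s) * (ennreal S * ennreal B)"
        by (intro mult_left_mono) auto
      also have "\<dots> = ennreal (\<Sum>m\<in>K. B * cmod (\<psi> m) * cmod (c (n + m)) * japanese_bracket n powr s)"
      proof -
        have "japanese_bracket n powr s * (S * B)
            = (\<Sum>m\<in>K. B * cmod (\<psi> m) * cmod (c (n + m)) * japanese_bracket n powr s)"
          by (simp add: S_def sum_distrib_left sum_distrib_right mult_ac)
        then show ?thesis using B \<open>0 \<le> S\<close> by (simp flip: ennreal_mult)
      qed
      also have "\<dots> \<le> ennreal (\<Sum>m\<in>K. B * cmod (\<psi> m) * cmod (c (n + m)) *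
          (L m * japanese_bracket (n + m) powr s))"
        using B japanese_bracket_powr_shift(1)[of n s]
        by (intro ennreal_leI sum_mono mult_left_mono) (auto simp: L_def)
      also have "\<dots> = (\<Sum>m\<in>K. ennreal (B * cmod (\<psi> m) * L m) * ennreal (weighted_modulus s c (n + m)))"
        using B L
        by (subst sum_ennreal[symmetric])
           (auto simp: weighted_modulus_def mult_ac simp flip: ennreal_mult)
      finally show ?thesis .
    qed
    have "modulation_norm \<psi> p q s c
        \<le> lp_norm q (\<lambda>n. \<Sum>m\<in>K. ennreal (B * cmod (\<psi> m) * L m) * ennreal (weighted_modulus s c (n + m)))"
      unfolding norm using assms by (intro Lp_norm_mono piece) auto
    also have "\<dots> < \<top>"
    proof (intro Lp_norm_sum_less_top Lp_norm_cmult_less_top)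
      show "lp_norm q (\<lambda>n. ennreal (weighted_modulus s c (n + m))) < \<top>" for m
        using lp_norm_reindex[OF assms(3) bij, of "\<lambda>n. ennreal (weighted_modulus s c n)" m] fin
        by simp
    qed (use assms B L in auto)
    finally show ?thesis .
  qed
  show "lp_norm q (\<lambda>n. ennreal (weighted_modulus s c n)) < \<top>"
    if fin: "modulation_norm \<psi> p q s c < \<top>"
  proof -
    \<comment> \<open>The window sums to \<open>1\<close>, so it does not vanish at some \<open>m\<close>; the \<open>n\<close>-th piece then sees the
      coefficient at \<open>n + m\<close>.\<close>
    have "(\<Sum>\<^sub>\<infinity>n\<in>UNIV. \<psi> (0 - n)) = 1"
      using assms unfolding modulation_window_def by blast
    moreover have "(\<Sum>\<^sub>\<infinity>n\<in>UNIV. \<psi> (0 - n)) = 0" if "\<And>m. \<psi> m = 0"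
      using that by simp
    ultimately obtain m where m: "\<psi> m \<noteq> 0" by (metis zero_neq_one)
    define C where "C = (2 * pi + 1) / cmod (\<psi> m) * L m"
    have "0 \<le> C" using L by (simp add: C_def)
    have le: "ennreal (weighted_modulus s c (n + m)) \<le> ennreal C * (ennreal (japanese_bracket n powr s) * e n)" for n
    proof -
      have piece: "window_piece \<psi> n c = (\<lambda>x. \<Sum>k | \<psi> (k - n) \<noteq> 0. \<psi> (k - n) * c k * cis (of_int k * x))"
        by (simp add: window_piece_def fun_eq_iff)
      have "{k. \<psi> (k - n) \<noteq> 0} = (\<lambda>m. n + m) ` K"
        by (auto simp: K_def image_iff intro!: exI[of _ "_ - n"])
      then have "fourier_coeff (window_piece \<psi> n c) (n + m) = \<psi> m * c (n + m)"
        unfolding piece using \<open>finite K\<close> m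
        by (subst fourier_coeff_trigonometric_polynomial) auto
      then have "ennreal (cmod (\<psi> m) * cmod (c (n + m))) \<le> ennreal (2 * pi + 1) * e n"
        using norm_fourier_coeff_le_Lp_norm[OF assms(2) borel_measurable_window_piece[of \<psi> n c], of "n + m"]
        by (simp add: e_def norm_mult)
      then have "ennreal (L m * japanese_bracket n powr s / cmod (\<psi> m)) * ennreal (cmod (\<psi> m) * cmod (c (n + m)))
          \<le> ennreal (L m * japanese_bracket n powr s / cmod (\<psi> m)) * (ennreal (2 * pi + 1) * e n)"
        by (intro mult_left_mono) auto
      also have "ennreal (L m * japanese_bracket n powr s / cmod (\<psi> m)) * ennreal (cmod (\<psi> m) * cmod (c (n + m)))
          = ennreal (L m * japanese_bracket n powr s * cmod (c (n + m)))"
        using m L by (simp flip: ennreal_mult)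
      also have "ennreal (L m * japanese_bracket n powr s / cmod (\<psi> m)) * (ennreal (2 * pi + 1) * e n)
          = ennreal C * (ennreal (japanese_bracket n powr s) * e n)"
      proof -
        have "ennreal (L m * japanese_bracket n powr s / cmod (\<psi> m)) * ennreal (2 * pi + 1)
            = ennreal C * ennreal (japanese_bracket n powr s)"
          using L[of m] \<open>0 \<le> C\<close> by (subst (1 2) ennreal_mult[symmetric]) (auto simp: C_def)
        then show ?thesis by (simp only: mult.assoc[symmetric])
      qed
      finally have "ennreal (L m * japanese_bracket n powr s * cmod (c (n + m)))
          \<le> ennreal C * (ennreal (japanese_bracket n powr s) * e n)" .
      moreover have "weighted_modulus s c (n + m) \<le> L m * japanese_bracket n powr s * cmod (c (n + m))"
        unfolding weighted_modulus_def L_def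
        by (intro mult_right_mono japanese_bracket_powr_shift) auto
      ultimately show ?thesis by (meson ennreal_leI order_trans)
    qed
    have "lp_norm q (\<lambda>n. ennreal (weighted_modulus s c (n + m)))
        \<le> lp_norm q (\<lambda>n. ennreal C * (ennreal (japanese_bracket n powr s) * e n))"
      using assms by (intro Lp_norm_mono le) auto
    also have "\<dots> < \<top>"
      using fin assms \<open>0 \<le> C\<close> by (intro Lp_norm_cmult_less_top) (auto simp: norm)
    finally show ?thesis
      using lp_norm_reindex[OF assms(3) bij, of "\<lambda>n. ennreal (weighted_modulus s c n)" m] by simp
  qed
qed

section \<open>Dyadic blocks\<close>

definition dyadic_block :: "nat \<Rightarrow> int set" where
  "dyadic_block k = {n. 2 ^ k \<le> \<bar>n\<bar> \<and> \<bar>n\<bar> < 2 ^ Suc k}"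

lemma dyadic_block_eq: "dyadic_block k = {2 ^ k..<2 ^ Suc k} \<union> {- (2 ^ Suc k)<..- (2 ^ k)}"
  unfolding dyadic_block_def
proof (intro set_eqI)
  fix n :: int
  have "(0::int) < 2 ^ k" by simp
  then show "n \<in> {n. 2 ^ k \<le> \<bar>n\<bar> \<and> \<bar>n\<bar> < 2 ^ Suc k} \<longleftrightarrow>
      n \<in> {2 ^ k..<2 ^ Suc k} \<union> {- (2 ^ Suc k)<..- (2 ^ k)}"
    by (auto simp: abs_if)
qed

lemma finite_dyadic_block [simp]: "finite (dyadic_block k)"
  by (simp add: dyadic_block_eq)

lemma card_dyadic_block: "card (dyadic_block k) = 2 ^ Suc k"
proof -
  have "(0::int) < 2 ^ k" by simp
  then have "{2 ^ k..<2 ^ Suc k} \<inter> {- (2 ^ Suc k)<..- (2 ^ k)} = ({} :: int set)"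
    by auto
  then show ?thesis
    unfolding dyadic_block_eq by (subst card_Un_disjoint) (auto simp: nat_power_eq)
qed

lemma zero_notin_dyadic_block [simp]: "0 \<notin> dyadic_block k"
  by (simp add: dyadic_block_def)

lemma ex_dyadic_block:
  assumes "n \<noteq> 0"
  obtains k where "n \<in> dyadic_block k"
proof -
  have "1 \<le> nat \<bar>n\<bar>" using assms by simp
  from ex_power_ivl1[OF order_refl this]
  obtain k where "2 ^ k \<le> nat \<bar>n\<bar>" "nat \<bar>n\<bar> < 2 ^ (k + 1)" by blast
  then have "int (2 ^ k) \<le> int (nat \<bar>n\<bar>)" "int (nat \<bar>n\<bar>) < int (2 ^ (k + 1))"
    by (simp_all only: of_nat_le_iff of_nat_less_iff)
  then have "n \<in> dyadic_block k" by (simp add: dyadic_block_def)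
  then show thesis by (rule that)
qed

lemma dyadic_block_le:
  assumes "n \<in> dyadic_block k" "\<bar>n\<bar> \<le> 2 ^ j"
  shows "k \<le> j"
proof -
  have "(2::int) ^ k \<le> 2 ^ j"
    using assms unfolding dyadic_block_def by (blast intro: order_trans)
  then show ?thesis by (simp)
qed

lemma dyadic_block_ge:
  assumes "n \<in> dyadic_block k" "2 ^ j \<le> \<bar>n\<bar>"
  shows "j \<le> k"
proof -
  have "(2::int) ^ j < 2 ^ Suc k" using assms unfolding dyadic_block_def by simp
  then have "j < Suc k" by (rule power_less_imp_less_exp[rotated]) simp
  then show ?thesis by simp
qed

lemma dyadic_block_unique: "n \<in> dyadic_block k \<Longrightarrow> n \<in> dyadic_block j \<Longrightarrow> j = k"
  by (intro antisym dyadic_block_ge[of n]) (auto simp: dyadic_block_def)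

definition block_seq :: "(int \<Rightarrow> real) \<Rightarrow> nat \<Rightarrow> int \<Rightarrow> ennreal" where
  "block_seq x k n = (if n \<in> dyadic_block k then ennreal (x n) else 0)"

definition block_norm :: "ennreal \<Rightarrow> (int \<Rightarrow> real) \<Rightarrow> nat \<Rightarrow> ennreal" where
  "block_norm p x k = lp_norm p (block_seq x k)"

lemma block_norm_less_top: "1 \<le> p \<Longrightarrow> block_norm p x k < \<top>"
  unfolding block_norm_def
  by (rule lp_norm_finite_support_less_top[of _ "dyadic_block k"]) (auto simp: block_seq_def)

lemma block_norm_ennreal:
  assumes "1 \<le> r" "\<And>n. 0 \<le> x n"
  shows "block_norm (ennreal r) x k = ennreal ((\<Sum>n\<in>dyadic_block k. x n powr r) powr (1 / r))"
proof -
  have "(\<integral>\<^sup>+ n. ennreal_powr (block_seq x k n) r \<partial>count_space UNIV)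
      = (\<Sum>n\<in>dyadic_block k. ennreal_powr (block_seq x k n) r)"
    by (intro nn_integral_count_space') (auto simp: block_seq_def)
  also have "\<dots> = (\<Sum>n\<in>dyadic_block k. ennreal (x n powr r))"
    using assms by (intro sum.cong) (auto simp: block_seq_def ennreal_powr_ennreal)
  finally show ?thesis
    using assms by (simp add: block_norm_def Lp_norm_ennreal ennreal_powr_ennreal sum_nonneg)
qed

lemma block_norm_top_le: "1 \<le> p \<Longrightarrow> block_norm \<infinity> x k \<le> block_norm p x k"
  unfolding block_norm_def by (rule lp_norm_top_le_lp_norm)

lemma le_block_norm: "1 \<le> p \<Longrightarrow> n \<in> dyadic_block k \<Longrightarrow> ennreal (x n) \<le> block_norm p x k"
  unfolding block_norm_def using le_lp_norm[of p "block_seq x k" n] by (simp add: block_seq_def)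

text \<open>The blocks partition the nonzero integers, so for equal inner and outer exponents the mixed
  norm is the plain sequence norm.\<close>
lemma lp_norm_less_top_iff_block_norm:
  assumes "1 \<le> p" "x 0 = 0"
  shows "lp_norm p (\<lambda>n. ennreal (x n)) < \<top> \<longleftrightarrow> lp_norm p (block_norm p x) < \<top>"
  using assms(1)
proof (cases p rule: exponent_cases)
  case top
  have "ennreal (x n) \<le> lp_norm \<infinity> (block_norm \<infinity> x)" for n
  proof (cases "n = 0")
    case False
    then obtain k where "n \<in> dyadic_block k" by (rule ex_dyadic_block)
    then have "ennreal (x n) \<le> block_norm \<infinity> x k" by (intro le_block_norm) auto
    also have "\<dots> \<le> lp_norm \<infinity> (block_norm \<infinity> x)" by (intro le_lp_norm) auto
    finally show ?thesis .
  qed (simp add: assms)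
  moreover have "block_norm \<infinity> x k \<le> lp_norm \<infinity> (\<lambda>n. ennreal (x n))" for k
    unfolding block_norm_def
    by (intro Lp_norm_mono) (auto simp: block_seq_def)
  ultimately show ?thesis
    unfolding top by (blast intro: lp_norm_top_less_top)
next
  case (real r)
  define h where "h k n = ennreal_powr (block_seq x k n) r" for k n
  have powr: "ennreal_powr (block_norm p x k) r = (\<integral>\<^sup>+ n. h k n \<partial>count_space UNIV)" for k
    using real by (simp add: block_norm_def Lp_norm_ennreal ennreal_powr_powr h_def)
  have single: "(\<integral>\<^sup>+ k. h k n \<partial>count_space UNIV) = ennreal_powr (ennreal (x n)) r" for n
  proof (cases "n = 0")
    case True
    then show ?thesis using assms by (simp add: h_def block_seq_def)
  next
    case False
    then obtain k where k: "n \<in> dyadic_block k" by (rule ex_dyadic_block)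
    have "(\<integral>\<^sup>+ k. h k n \<partial>count_space UNIV) = (\<Sum>j\<in>{k}. h j n)"
      by (intro nn_integral_count_space') (auto simp: h_def block_seq_def dest: dyadic_block_unique[OF k])
    then show ?thesis using k by (simp add: h_def block_seq_def)
  qed
  have "(\<integral>\<^sup>+ k. ennreal_powr (block_norm p x k) r \<partial>count_space UNIV)
      = (\<integral>\<^sup>+ n. ennreal_powr (ennreal (x n)) r \<partial>count_space UNIV)"
    unfolding powr single[symmetric]
    by (rule nn_integral_count_space_nn_integral[symmetric]) auto
  then show ?thesis using real by (simp add: Lp_norm_less_top_iff)
qed

section \<open>Fourier-Besov norms are mixed norms over dyadic blocks\<close>

lemma dyadic_partition_bounded:
  assumes "dyadic_partition \<phi>\<^sub>0 \<phi>"
  obtains C where "0 \<le> C" "\<And>j \<xi>. cmod (dyadic_piece \<phi>\<^sub>0 \<phi> j \<xi>) \<le> C"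
proof -
  have bounded: "bounded (range f)" if "schwartz_function f" for f
  proof -
    from that obtain F :: "nat \<Rightarrow> real \<Rightarrow> complex" where
      F: "F 0 = f" "\<forall>k m. bounded (range (\<lambda>x. x ^ m *\<^sub>R F k x))"
      unfolding schwartz_function_def by metis
    show ?thesis using F(1) F(2)[rule_format, of 0 0] by simp
  qed
  have schwartz: "schwartz_function \<phi>\<^sub>0" "schwartz_function \<phi>"
    using assms by (auto simp: dyadic_partition_def)
  obtain A where A: "\<And>\<xi>. cmod (\<phi>\<^sub>0 \<xi>) \<le> A"
    using bounded[OF schwartz(1)] by (auto simp: bounded_iff)
  obtain B where B: "\<And>\<xi>. cmod (\<phi> \<xi>) \<le> B"
    using bounded[OF schwartz(2)] by (auto simp: bounded_iff)
  show thesis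
  proof (rule that)
    show "0 \<le> max A B"
      using order_trans[OF norm_ge_zero A] by (simp add: le_max_iff_disj)
    show "cmod (dyadic_piece \<phi>\<^sub>0 \<phi> j \<xi>) \<le> max A B" for j \<xi>
      using A B by (simp add: dyadic_piece_def le_max_iff_disj)
  qed
qed

lemma dyadic_piece_support:
  assumes "dyadic_partition \<phi>\<^sub>0 \<phi>" "dyadic_piece \<phi>\<^sub>0 \<phi> j \<xi> \<noteq> 0"
  shows "\<bar>\<xi>\<bar> \<le> 2 ^ Suc j" "0 < j \<Longrightarrow> 2 ^ (j - 1) \<le> \<bar>\<xi>\<bar>"
proof -
  have supp: "\<bar>\<xi>\<bar> \<le> 2" if "\<phi>\<^sub>0 \<xi> \<noteq> 0" for \<xi>
    using assms(1) that closure_subset[of "{\<xi>. \<phi>\<^sub>0 \<xi> \<noteq> 0}"] unfolding dyadic_partition_def by blast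
  have supp': "1 / 2 \<le> \<bar>\<xi>\<bar> \<and> \<bar>\<xi>\<bar> \<le> 2" if "\<phi> \<xi> \<noteq> 0" for \<xi>
    using assms(1) that closure_subset[of "{\<xi>. \<phi> \<xi> \<noteq> 0}"] unfolding dyadic_partition_def by blast
  show "\<bar>\<xi>\<bar> \<le> 2 ^ Suc j"
    using assms(2) supp[of \<xi>] supp'[of "\<xi> / 2 ^ j"]
    by (auto simp: dyadic_piece_def field_simps split: if_splits)
  show "2 ^ (j - 1) \<le> \<bar>\<xi>\<bar>" if "0 < j"
    using assms(2) that supp'[of "\<xi> / 2 ^ j"]
    by (cases j) (auto simp: dyadic_piece_def field_simps)
qed

text \<open>The support \<open>2\<^sup>j\<^sup>-\<^sup>1 \<le> |n| \<le> 2\<^sup>j\<^sup>+\<^sup>1\<close> of the \<open>j\<close>-th piece covers the blocks \<open>j - 1\<close> and \<open>j\<close>, and its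
  endpoint \<open>2\<^sup>j\<^sup>+\<^sup>1\<close> already belongs to the block \<open>j + 1\<close>.\<close>
lemma dyadic_piece_nonzero_block:
  assumes "dyadic_partition \<phi>\<^sub>0 \<phi>" "dyadic_piece \<phi>\<^sub>0 \<phi> j (of_int n) \<noteq> 0" "n \<in> dyadic_block k"
  shows "k \<le> Suc j" "j \<le> Suc k"
proof -
  note supp = dyadic_piece_support[OF assms(1,2)]
  have "real_of_int \<bar>n\<bar> \<le> real_of_int (2 ^ Suc j)" using supp(1) by simp
  then show "k \<le> Suc j"
    using dyadic_block_le[OF assms(3)] by (simp only: of_int_le_iff)
  show "j \<le> Suc k"
  proof (cases "0 < j")
    case True
    then have "real_of_int (2 ^ (j - 1)) \<le> real_of_int \<bar>n\<bar>" using supp(2) by simp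
    then have "j - 1 \<le> k"
      using dyadic_block_ge[OF assms(3)] by (simp only: of_int_le_iff)
    then show ?thesis by simp
  qed simp
qed

text \<open>The partition of unity reduces to three neighbouring pieces. The block index is at least \<open>2\<close>
  so that the piece \<open>0\<close> is not among them and only rescalings of \<open>\<phi>\<close> occur.\<close>
lemma sum_dyadic_pieces_ge_1:
  assumes "dyadic_partition \<phi>\<^sub>0 \<phi>" "n \<in> dyadic_block (k + 2)"
  shows "1 \<le> (\<Sum>i\<in>{1..3}. cmod (dyadic_piece \<phi>\<^sub>0 \<phi> (k + i) (of_int n)))"
proof -
  have zero: "dyadic_piece \<phi>\<^sub>0 \<phi> j (of_int n) = 0" if "j \<notin> {k + 1..k + 3}" for j
    using dyadic_piece_nonzero_block[OF assms(1) _ assms(2), of j] that by force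
  have zero': "\<phi> (of_int n / 2 ^ j) = 0" if "1 \<le> j" "j \<notin> {k + 1..k + 3}" for j
    using zero[OF that(2)] that(1) by (simp add: dyadic_piece_def)
  have "1 = \<phi>\<^sub>0 (of_int n) + (\<Sum>\<^sub>\<infinity>j\<in>{1::nat..}. \<phi> (of_int n / 2 ^ j))"
    using assms(1) by (simp add: dyadic_partition_def)
  also have "\<phi>\<^sub>0 (of_int n) = 0"
    using zero[of 0] by (simp add: dyadic_piece_def)
  also have "(\<Sum>\<^sub>\<infinity>j\<in>{1::nat..}. \<phi> (of_int n / 2 ^ j))
      = (\<Sum>\<^sub>\<infinity>j\<in>{k + 1..k + 3}. dyadic_piece \<phi>\<^sub>0 \<phi> j (of_int n))"
    by (rule infsum_cong_neutral) (use zero' in \<open>auto simp: dyadic_piece_def\<close>)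
  also have "\<dots> = (\<Sum>j\<in>{k + 1..k + 3}. dyadic_piece \<phi>\<^sub>0 \<phi> j (of_int n))"
    by simp
  also have "\<dots> = (\<Sum>i\<in>{1..3}. dyadic_piece \<phi>\<^sub>0 \<phi> (k + i) (of_int n))"
    using sum.shift_bounds_cl_nat_ivl[of "\<lambda>j. dyadic_piece \<phi>\<^sub>0 \<phi> j (of_int n)" 1 k 3]
    by (simp add: add.commute)
  finally have "cmod 1 = cmod (\<Sum>i\<in>{1..3}. dyadic_piece \<phi>\<^sub>0 \<phi> (k + i) (of_int n))"
    by simp
  also have "\<dots> \<le> (\<Sum>i\<in>{1..3}. cmod (dyadic_piece \<phi>\<^sub>0 \<phi> (k + i) (of_int n)))"
    by (rule norm_sum)
  finally show ?thesis by simp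
qed

text \<open>Each piece of the partition is bounded and lives on three neighbouring blocks, and on each
  block from the index \<open>2\<close> on the moduli of three neighbouring pieces add up to at least \<open>1\<close>. So the
  norms of the pieces and of the blocks dominate each other up to shifts of the index by at most one
  and up to the first two blocks, whose norms are finite.\<close>
lemma fourier_besov_norm_less_top_iff:
  assumes partition: "dyadic_partition \<phi>\<^sub>0 \<phi>" and pq: "1 \<le> p" "1 \<le> q" and "c 0 = 0"
  shows "fourier_besov_norm \<phi>\<^sub>0 \<phi> p q s c < \<top> \<longleftrightarrow>
      lp_norm q (block_norm p (weighted_modulus s c)) < \<top>"
proof
  define x where "x = weighted_modulus s c"
  define b where "b = block_seq x"
  define N where "N = block_norm p x"
  have "x 0 = 0" using assms by (simp add: x_def weighted_modulus_def)
  define e where "e j n = ennreal (cmod (dyadic_piece \<phi>\<^sub>0 \<phi> j (of_int n)) * x n)" for j n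
  define A where "A j = lp_norm p (e j)" for j
  have norm: "fourier_besov_norm \<phi>\<^sub>0 \<phi> p q s c = lp_norm q A"
    by (simp add: fourier_besov_norm_def A_def[abs_def] e_def[abs_def] x_def weighted_modulus_def
        norm_mult mult_ac)
  have lp_b: "lp_norm p (b k) = N k" for k by (simp add: b_def N_def block_norm_def)
  have N: "N k < \<top>" for k using pq by (simp add: N_def block_norm_less_top)
  have shift: "lp_norm q (\<lambda>k. f (k + m)) < \<top>" if "lp_norm q f < \<top>" for f :: "nat \<Rightarrow> ennreal" and m
    using lp_norm_shift_less_top_iff[OF pq(2), of f m] that by simp
  show "fourier_besov_norm \<phi>\<^sub>0 \<phi> p q s c < \<top>"
    if fin: "lp_norm q (block_norm p (weighted_modulus s c)) < \<top>"
  proof -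
    have fin: "lp_norm q N < \<top>" using fin by (simp add: N_def x_def)
    obtain C where C: "0 \<le> C" "\<And>j \<xi>. cmod (dyadic_piece \<phi>\<^sub>0 \<phi> j \<xi>) \<le> C"
      using dyadic_partition_bounded[OF partition] by blast
    have e_le: "e j n \<le> ennreal C * (b (j - 1) n + b j n + b (j + 1) n)" for j n
    proof (cases "n = 0 \<or> dyadic_piece \<phi>\<^sub>0 \<phi> j (of_int n) = 0")
      case True
      then show ?thesis using \<open>x 0 = 0\<close> by (auto simp: e_def)
    next
      case False
      then obtain k where k: "n \<in> dyadic_block k" using ex_dyadic_block by blast
      have "k \<in> {j - 1, j, j + 1}"
        using dyadic_piece_nonzero_block[OF partition _ k, of j] False by auto
      then have "b k n \<le> b (j - 1) n + b j n + b (j + 1) n"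
        by (auto intro: add_increasing add_increasing2)
      moreover have "e j n \<le> ennreal C * b k n"
        using C k unfolding e_def b_def block_seq_def
        by (auto simp: x_def mult_right_mono simp flip: ennreal_mult intro!: ennreal_leI)
      ultimately show ?thesis by (meson mult_left_mono order_trans zero_le)
    qed
    have "A j \<le> ennreal (C * 16) * (N (j - 1) + N j + N (j + 1))" for j
    proof -
      have "A j \<le> lp_norm p (\<lambda>n. ennreal C * (b (j - 1) n + b j n + b (j + 1) n))"
        unfolding A_def using pq e_le by (intro Lp_norm_mono) auto
      also have "\<dots> \<le> ennreal C * lp_norm p (\<lambda>n. b (j - 1) n + b j n + b (j + 1) n)"
        using pq C by (intro Lp_norm_cmult_le) auto
      also have "\<dots> \<le> ennreal C * (16 * (N (j - 1) + N j + N (j + 1)))"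
        unfolding lp_b[symmetric] using pq by (intro mult_left_mono Lp_norm_add3_le) auto
      also have "\<dots> = ennreal (C * 16) * (N (j - 1) + N j + N (j + 1))"
        using C by (simp add: ennreal_mult mult.assoc)
      finally show ?thesis .
    qed
    then have "lp_norm q A \<le> lp_norm q (\<lambda>j. ennreal (C * 16) * (N (j - 1) + N j + N (j + 1)))"
      using pq by (intro Lp_norm_mono) auto
    also have "\<dots> < \<top>"
    proof (intro Lp_norm_cmult_less_top lp_norm_add3_less_top)
      \<comment> \<open>Truncated subtraction repeats \<open>N 0\<close> at the index \<open>0\<close>, which adds one finite term.\<close>
      show "lp_norm q (\<lambda>j. N (j - 1)) < \<top>"
        using lp_norm_Suc_less_top_iff[OF pq(2), of "\<lambda>j. N (j - 1)"] fin N by simp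
      show "lp_norm q (\<lambda>j. N (j + 1)) < \<top>" by (intro shift fin)
    qed (use pq C fin in auto)
    finally show ?thesis by (simp add: norm)
  qed
  show "lp_norm q (block_norm p (weighted_modulus s c)) < \<top>"
    if fin: "fourier_besov_norm \<phi>\<^sub>0 \<phi> p q s c < \<top>"
  proof -
    have fin: "lp_norm q A < \<top>" using fin by (simp add: norm)
    have b_le: "b (k + 2) n \<le> e (k + 1) n + e (k + 2) n + e (k + 3) n" for k n
    proof (cases "n \<in> dyadic_block (k + 2)")
      case True
      have "1 * x n \<le> (\<Sum>i\<in>{1..3}. cmod (dyadic_piece \<phi>\<^sub>0 \<phi> (k + i) (of_int n))) * x n"
        using sum_dyadic_pieces_ge_1[OF partition True] by (intro mult_right_mono) (auto simp: x_def)
      also have "\<dots> = (\<Sum>i\<in>{1..3}. cmod (dyadic_piece \<phi>\<^sub>0 \<phi> (k + i) (of_int n)) * x n)"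
        by (simp add: sum_distrib_right)
      finally have "ennreal (x n) \<le> ennreal (\<Sum>i\<in>{1..3}. cmod (dyadic_piece \<phi>\<^sub>0 \<phi> (k + i) (of_int n)) * x n)"
        by (simp add: ennreal_leI)
      also have "\<dots> = (\<Sum>i\<in>{1..3}. e (k + i) n)"
        by (simp add: e_def x_def)
      also have "\<dots> = e (k + 1) n + e (k + 2) n + e (k + 3) n"
        by (simp add: numeral_3_eq_3 numeral_2_eq_2)
      finally show ?thesis using True by (simp add: b_def block_seq_def)
    qed (simp add: b_def block_seq_def)
    have "N (k + 2) \<le> 16 * (A (k + 1) + A (k + 2) + A (k + 3))" for k
    proof -
      have "N (k + 2) \<le> lp_norm p (\<lambda>n. e (k + 1) n + e (k + 2) n + e (k + 3) n)"
        unfolding lp_b[symmetric] using pq b_le by (intro Lp_norm_mono) auto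
      also have "\<dots> \<le> 16 * (A (k + 1) + A (k + 2) + A (k + 3))"
        unfolding A_def using pq by (intro Lp_norm_add3_le) auto
      finally show ?thesis .
    qed
    then have "lp_norm q (\<lambda>k. N (k + 2)) \<le> lp_norm q (\<lambda>k. ennreal 16 * (A (k + 1) + A (k + 2) + A (k + 3)))"
      using pq by (intro Lp_norm_mono) auto
    also have "\<dots> < \<top>"
      by (intro Lp_norm_cmult_less_top lp_norm_add3_less_top shift fin) (use pq in auto)
    finally show ?thesis
      using lp_norm_shift_less_top_iff[OF pq(2), of N 2] N by (simp add: N_def x_def)
  qed
qed

section \<open>A law of large numbers along dyadic blocks\<close>

context prob_space
begin

lemma variance_sum_indep:
  fixes X :: "'i \<Rightarrow> 'a \<Rightarrow> real"
  assumes "finite I" "indep_vars (\<lambda>_. borel) X I"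
    and "\<And>i. i \<in> I \<Longrightarrow> integrable M (X i)" "\<And>i. i \<in> I \<Longrightarrow> integrable M (\<lambda>\<omega>. (X i \<omega>)\<^sup>2)"
  shows "integrable M (\<lambda>\<omega>. (\<Sum>i\<in>I. X i \<omega>)\<^sup>2) \<and> variance (\<lambda>\<omega>. \<Sum>i\<in>I. X i \<omega>) = (\<Sum>i\<in>I. variance (X i))"
  using assms
proof (induction I)
  case empty
  then show ?case by simp
next
  case (insert i I)
  define S where "S \<omega> = (\<Sum>i\<in>I. X i \<omega>)" for \<omega>
  have indep: "indep_var borel (X i) borel S"
    unfolding S_def using insert by (intro indep_vars_sum) auto
  have IH: "integrable M (\<lambda>\<omega>. (S \<omega>)\<^sup>2)" "variance S = (\<Sum>i\<in>I. variance (X i))"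
    using insert.IH insert.prems indep_vars_subset[OF insert.prems(1), of I]
    by (auto simp: S_def[abs_def])
  have X: "integrable M (X i)" "integrable M (\<lambda>\<omega>. (X i \<omega>)\<^sup>2)" and S: "integrable M S"
    using insert.prems by (auto simp: S_def[abs_def])
  have prod: "integrable M (\<lambda>\<omega>. X i \<omega> * S \<omega>)"
    "expectation (\<lambda>\<omega>. X i \<omega> * S \<omega>) = expectation (X i) * expectation S"
    by (rule indep_var_integrable[OF indep X(1) S] indep_var_lebesgue_integral[OF indep X(1) S])+
  have square: "(X i \<omega> + S \<omega>)\<^sup>2 = (X i \<omega>)\<^sup>2 + (S \<omega>)\<^sup>2 + 2 * (X i \<omega> * S \<omega>)" for \<omega>
    by (simp add: power2_eq_square algebra_simps)
  have sq: "integrable M (\<lambda>\<omega>. (X i \<omega> + S \<omega>)\<^sup>2)"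
    unfolding square using X IH prod by auto
  have "variance (\<lambda>\<omega>. X i \<omega> + S \<omega>) = expectation (\<lambda>\<omega>. (X i \<omega> + S \<omega>)\<^sup>2) - (expectation (\<lambda>\<omega>. X i \<omega> + S \<omega>))\<^sup>2"
    using sq X S by (intro variance_eq) auto
  also have "\<dots> = variance (X i) + variance S"
  proof -
    have "expectation (\<lambda>\<omega>. (X i \<omega> + S \<omega>)\<^sup>2)
        = expectation (\<lambda>\<omega>. (X i \<omega>)\<^sup>2) + expectation (\<lambda>\<omega>. (S \<omega>)\<^sup>2) + 2 * (expectation (X i) * expectation S)"
      unfolding square using X IH(1) prod by simp
    moreover have "expectation (\<lambda>\<omega>. X i \<omega> + S \<omega>) = expectation (X i) + expectation S"
      using X S by simp
    ultimately show ?thesis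
      unfolding variance_eq[OF X] variance_eq[OF S IH(1)] by (simp add: power2_sum)
  qed
  finally show ?case
    using insert.hyps sq IH by (simp add: S_def[abs_def])
qed

text \<open>By Chebyshev's inequality the probability of a deviation on the \<open>k\<close>-th block is \<open>O(2\<^sup>-\<^sup>k)\<close>,
  which is summable, so Borel-Cantelli applies to the blocks themselves.\<close>
lemma AE_dyadic_block_average:
  fixes X :: "int \<Rightarrow> 'a \<Rightarrow> real"
  assumes indep: "indep_vars (\<lambda>_. borel) X {n. n \<noteq> 0}"
    and int: "\<And>n. n \<noteq> 0 \<Longrightarrow> integrable M (X n)" "\<And>n. n \<noteq> 0 \<Longrightarrow> integrable M (\<lambda>\<omega>. (X n \<omega>)\<^sup>2)"
    and mean: "\<And>n. n \<noteq> 0 \<Longrightarrow> expectation (X n) = \<mu>"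
    and var: "\<And>n. n \<noteq> 0 \<Longrightarrow> variance (X n) \<le> v"
    and "0 < \<epsilon>"
  shows "AE \<omega> in M. eventually (\<lambda>k. \<bar>(\<Sum>n\<in>dyadic_block k. X n \<omega>) - 2 ^ Suc k * \<mu>\<bar> < 2 ^ Suc k * \<epsilon>) sequentially"
proof -
  define S where "S k \<omega> = (\<Sum>n\<in>dyadic_block k. X n \<omega>)" for k \<omega>
  have block: "n \<noteq> 0" if "n \<in> dyadic_block k" for n k
    using that by auto
  have [measurable]: "X n \<in> borel_measurable M" if "n \<noteq> 0" for n
    using int(1)[OF that] by auto
  have [measurable]: "S k \<in> borel_measurable M" for k
    unfolding S_def[abs_def] using block by auto
  define A where "A k = {\<omega> \<in> space M. 2 ^ Suc k * \<epsilon> \<le> \<bar>S k \<omega> - expectation (S k)\<bar>}" for k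
  have A: "A k \<in> sets M" for k unfolding A_def by measurable
  have ES: "expectation (S k) = 2 ^ Suc k * \<mu>" for k
  proof -
    have "expectation (S k) = (\<Sum>n\<in>dyadic_block k. expectation (X n))"
      unfolding S_def using block int by (intro Bochner_Integration.integral_sum) auto
    also have "\<dots> = 2 ^ Suc k * \<mu>"
      using mean block by (simp add: card_dyadic_block)
    finally show ?thesis .
  qed
  have prob_A: "prob (A k) \<le> v / \<epsilon>\<^sup>2 * (1 / 2) ^ k" for k
  proof -
    have sub: "dyadic_block k \<subseteq> {n. n \<noteq> 0}" using block by auto
    have S: "integrable M (\<lambda>\<omega>. (S k \<omega>)\<^sup>2)" "variance (S k) = (\<Sum>n\<in>dyadic_block k. variance (X n))"
      using variance_sum_indep[OF finite_dyadic_block indep_vars_subset[OF indep sub]] int block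
      by (auto simp: S_def[abs_def])
    have "variance (S k) \<le> (\<Sum>n\<in>dyadic_block k. v)"
      unfolding S using var block by (intro sum_mono) auto
    then have "variance (S k) \<le> 2 ^ Suc k * v"
      by (simp add: card_dyadic_block)
    have "prob (A k) \<le> variance (S k) / (2 ^ Suc k * \<epsilon>)\<^sup>2"
      unfolding A_def using S \<open>0 < \<epsilon>\<close> by (intro Chebyshev_inequality) auto
    also have "\<dots> \<le> 2 ^ Suc k * v / (2 ^ Suc k * \<epsilon>)\<^sup>2"
      by (intro divide_right_mono) (fact, simp)
    also have "\<dots> = v / \<epsilon>\<^sup>2 * (1 / 2) ^ Suc k"
      using \<open>0 < \<epsilon>\<close> by (simp add: power2_eq_square field_simps)
    also have "\<dots> \<le> v / \<epsilon>\<^sup>2 * (1 / 2) ^ k"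
    proof -
      have "0 \<le> variance (X 1)" by simp
      then have "0 \<le> v" using var[of 1] by linarith
      then show ?thesis by (intro mult_left_mono) auto
    qed
    finally show ?thesis .
  qed
  have "summable (\<lambda>k. prob (A k))"
    by (rule summable_comparison_test'[of "\<lambda>k. v / \<epsilon>\<^sup>2 * (1 / 2) ^ k" 0])
       (use prob_A in \<open>auto intro!: summable_mult summable_geometric\<close>)
  then have "AE \<omega> in M. eventually (\<lambda>k. \<omega> \<in> space M - A k) sequentially"
    using A by (intro borel_cantelli_AE1) (auto simp: emeasure_eq_measure)
  then show ?thesis
  proof eventually_elim
    case (elim \<omega>)
    then show ?case
      by eventually_elim (auto simp: A_def ES S_def)
  qed
qed

section \<open>Complex Gaussian variables\<close>

text \<open>Independence of the two parts fixes the joint law, so all standard complex Gaussians are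
  identically distributed and have the same moments.\<close>
lemma standard_complex_gaussian_distr:
  assumes "standard_complex_gaussian M X"
  shows "distr M borel X = distr
    (density lborel (\<lambda>x. ennreal (std_normal_density x)) \<Otimes>\<^sub>M density lborel (\<lambda>x. ennreal (std_normal_density x)))
    borel (\<lambda>(x, y). Complex x y)"
proof -
  have Re: "distr M lborel (\<lambda>\<omega>. Re (X \<omega>)) = density lborel (\<lambda>x. ennreal (std_normal_density x))"
    and Im: "distr M lborel (\<lambda>\<omega>. Im (X \<omega>)) = density lborel (\<lambda>x. ennreal (std_normal_density x))"
    and indep: "indep_var borel (\<lambda>\<omega>. Re (X \<omega>)) borel (\<lambda>\<omega>. Im (X \<omega>))"
    using assms unfolding standard_complex_gaussian_def by (auto dest: distributed_distr_eq_density)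
  have [measurable]: "(\<lambda>\<omega>. Re (X \<omega>)) \<in> borel_measurable M" "(\<lambda>\<omega>. Im (X \<omega>)) \<in> borel_measurable M"
    using indep by (auto dest: indep_var_rv1 indep_var_rv2)
  have Complex_eq: "Complex a b = complex_of_real a + \<i> * complex_of_real b" for a b
    by (simp add: complex_eq_iff)
  have [measurable]: "(\<lambda>(x, y). Complex x y) \<in> borel_measurable (borel \<Otimes>\<^sub>M borel)"
    unfolding Complex_eq by measurable
  have "distr M borel X = distr (distr M (borel \<Otimes>\<^sub>M borel) (\<lambda>\<omega>. (Re (X \<omega>), Im (X \<omega>)))) borel (\<lambda>(x, y). Complex x y)"
    by (subst distr_distr) (auto simp: comp_def)
  also have "distr M (borel \<Otimes>\<^sub>M borel) (\<lambda>\<omega>. (Re (X \<omega>), Im (X \<omega>)))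
      = distr M borel (\<lambda>\<omega>. Re (X \<omega>)) \<Otimes>\<^sub>M distr M borel (\<lambda>\<omega>. Im (X \<omega>))"
    using indep unfolding indep_var_distribution_eq by simp
  also have "distr M borel (\<lambda>\<omega>. Re (X \<omega>)) = distr M lborel (\<lambda>\<omega>. Re (X \<omega>))"
    by (rule distr_cong) auto
  also have "distr M borel (\<lambda>\<omega>. Im (X \<omega>)) = distr M lborel (\<lambda>\<omega>. Im (X \<omega>))"
    by (rule distr_cong) auto
  finally show ?thesis unfolding Re Im .
qed

lemma standard_complex_gaussian_measurable:
  assumes "standard_complex_gaussian M X"
  shows "X \<in> borel_measurable M"
proof -
  have [measurable]: "(\<lambda>\<omega>. Re (X \<omega>)) \<in> borel_measurable M" "(\<lambda>\<omega>. Im (X \<omega>)) \<in> borel_measurable M"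
    using assms unfolding standard_complex_gaussian_def
    by (auto dest: indep_var_rv1 indep_var_rv2)
  have "(\<lambda>\<omega>. complex_of_real (Re (X \<omega>)) + \<i> * complex_of_real (Im (X \<omega>))) \<in> borel_measurable M"
    by measurable
  then show ?thesis by (simp flip: complex_eq)
qed

lemma standard_complex_gaussian_expectation_eq:
  fixes h :: "complex \<Rightarrow> real"
  assumes "standard_complex_gaussian M X" "standard_complex_gaussian M Y" "h \<in> borel_measurable borel"
  shows "expectation (\<lambda>\<omega>. h (X \<omega>)) = expectation (\<lambda>\<omega>. h (Y \<omega>))"
proof -
  have "expectation (\<lambda>\<omega>. h (Z \<omega>)) = (LINT z|distr M borel Z. h z)" if "standard_complex_gaussian M Z" for Z
    using standard_complex_gaussian_measurable[OF that] assms(3) by (simp add: integral_distr)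
  then show ?thesis
    using assms standard_complex_gaussian_distr[OF assms(1)] standard_complex_gaussian_distr[OF assms(2)]
    by simp
qed

lemma std_normal_moment_integrable:
  assumes "distributed M lborel Z std_normal_density"
  shows "integrable M (\<lambda>\<omega>. \<bar>Z \<omega>\<bar> ^ m)"
proof -
  have "integrable lborel (\<lambda>x. std_normal_density x *\<^sub>R \<bar>x\<bar> ^ m)"
    using integrable_std_normal_moment_abs[of m] by simp
  then show ?thesis
    using distributed_integrable[OF assms, of "\<lambda>x. \<bar>x\<bar> ^ m"] by simp
qed

lemma standard_complex_gaussian_moment:
  assumes X: "standard_complex_gaussian M X" and "0 \<le> r"
  shows "integrable M (\<lambda>\<omega>. cmod (X \<omega>) powr r)"
proof -
  note [measurable] = standard_complex_gaussian_measurable[OF X]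
  define m where "m = nat \<lceil>r\<rceil>"
  have "r \<le> real m" unfolding m_def using assms by linarith
  have bound: "cmod z powr r \<le> 1 + 2 ^ m * (\<bar>Re z\<bar> ^ m + \<bar>Im z\<bar> ^ m)" for z
  proof (cases "cmod z \<le> 1")
    case True
    then have "cmod z powr r \<le> 1"
      using powr_mono2[of r "cmod z" 1] assms by simp
    also have "\<dots> \<le> 1 + 2 ^ m * (\<bar>Re z\<bar> ^ m + \<bar>Im z\<bar> ^ m)" by simp
    finally show ?thesis .
  next
    case False
    then have "cmod z powr r \<le> cmod z powr real m"
      using \<open>r \<le> real m\<close> by (intro powr_mono) auto
    also have "\<dots> = cmod z ^ m"
      using False by (intro powr_realpow) linarith
    also have "\<dots> \<le> (2 * max \<bar>Re z\<bar> \<bar>Im z\<bar>) ^ m"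
      using cmod_le[of z] by (intro power_mono) auto
    also have "\<dots> = 2 ^ m * max \<bar>Re z\<bar> \<bar>Im z\<bar> ^ m"
      by (simp add: power_mult_distrib)
    also have "\<dots> \<le> 2 ^ m * (\<bar>Re z\<bar> ^ m + \<bar>Im z\<bar> ^ m)"
      by (intro mult_left_mono) (auto simp: max_def)
    finally show ?thesis by simp
  qed
  have "integrable M (\<lambda>\<omega>. 1 + 2 ^ m * (\<bar>Re (X \<omega>)\<bar> ^ m + \<bar>Im (X \<omega>)\<bar> ^ m))"
    using X unfolding standard_complex_gaussian_def
    by (intro Bochner_Integration.integrable_add integrable_mult_right std_normal_moment_integrable) auto
  then show ?thesis
    by (rule Bochner_Integration.integrable_bound) (use bound in \<open>auto intro: order_trans[OF _ abs_ge_self]\<close>)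
qed

text \<open>The modulus dominates the real part, whose density is positive on the whole line.\<close>
lemma standard_complex_gaussian_tail_pos:
  assumes X: "standard_complex_gaussian M X"
  shows "0 < prob {\<omega> \<in> space M. K < cmod (X \<omega>)}"
proof (rule ccontr)
  note [measurable] = standard_complex_gaussian_measurable[OF X]
  assume "\<not> 0 < prob {\<omega> \<in> space M. K < cmod (X \<omega>)}"
  then have "prob {\<omega> \<in> space M. K < cmod (X \<omega>)} = 0"
    using measure_nonneg[of M] by (simp add: not_less antisym)
  then have "prob ((\<lambda>\<omega>. Re (X \<omega>)) -` {K<..} \<inter> space M) \<le> 0"
    using finite_measure_mono[of "(\<lambda>\<omega>. Re (X \<omega>)) -` {K<..} \<inter> space M" "{\<omega> \<in> space M. K < cmod (X \<omega>)}"]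
      complex_Re_le_cmod by (fastforce intro: less_le_trans)
  then have "emeasure M ((\<lambda>\<omega>. Re (X \<omega>)) -` {K<..} \<inter> space M) = 0"
    by (simp add: emeasure_eq_measure measure_le_0_iff)
  moreover have "emeasure M ((\<lambda>\<omega>. Re (X \<omega>)) -` {K<..} \<inter> space M)
      = (\<integral>\<^sup>+ x. ennreal (std_normal_density x) * indicator {K<..} x \<partial>lborel)"
    using X unfolding standard_complex_gaussian_def by (intro distributed_emeasure) auto
  ultimately have "AE x in lborel. ennreal (std_normal_density x) * indicator {K<..} x = 0"
    by (simp add: nn_integral_0_iff_AE)
  then have "AE x in lborel. x \<notin> {K<..}"
  proof eventually_elim
    case (elim x)
    have "0 < std_normal_density x" by (intro normal_density_pos) simp
    with elim show ?case by (auto simp: indicator_def split: if_splits)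
  qed
  then have "emeasure lborel {K<..} = 0"
    by (subst (asm) AE_iff_measurable[of "{K<..}"]) auto
  moreover have "emeasure lborel {K<..K + 1} \<le> emeasure lborel {K<..}"
    by (intro emeasure_mono) auto
  ultimately show False by simp
qed

lemma standard_complex_gaussian_moment_pos:
  assumes X: "standard_complex_gaussian M X" and "0 \<le> r"
  shows "0 < expectation (\<lambda>\<omega>. cmod (X \<omega>) powr r)"
proof (rule ccontr)
  note [measurable] = standard_complex_gaussian_measurable[OF X]
  assume "\<not> 0 < expectation (\<lambda>\<omega>. cmod (X \<omega>) powr r)"
  then have "expectation (\<lambda>\<omega>. cmod (X \<omega>) powr r) = 0"
    by (intro antisym) (auto simp: not_less)
  then have "AE \<omega> in M. cmod (X \<omega>) powr r = 0"
    using standard_complex_gaussian_moment[OF assms] by (simp add: integral_nonneg_eq_0_iff_AE)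
  then have "AE \<omega> in M. \<omega> \<notin> {\<omega> \<in> space M. 0 < cmod (X \<omega>)}"
    by eventually_elim auto
  then have "prob {\<omega> \<in> space M. 0 < cmod (X \<omega>)} = 0"
    by (subst prob_eq_0) auto
  with standard_complex_gaussian_tail_pos[OF X, of 0] show False by simp
qed

text \<open>The block has \<open>2\<^sup>k\<^sup>+\<^sup>1\<close> elements, so the sum concentrates at twice \<open>\<mu> 2\<^sup>k\<close>, where \<open>\<mu>\<close> is the
  common mean; deviations of at most half of that are allowed.\<close>
lemma AE_gaussian_dyadic_block_average:
  fixes h :: "complex \<Rightarrow> real"
  assumes indep: "indep_vars (\<lambda>_. borel) g {n. n \<noteq> (0::int)}"
    and gauss: "\<And>n. n \<noteq> 0 \<Longrightarrow> standard_complex_gaussian M (g n)"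
    and [measurable]: "h \<in> borel_measurable borel"
    and int: "\<And>n. n \<noteq> 0 \<Longrightarrow> integrable M (\<lambda>\<omega>. h (g n \<omega>))" "\<And>n. n \<noteq> 0 \<Longrightarrow> integrable M (\<lambda>\<omega>. (h (g n \<omega>))\<^sup>2)"
    and pos: "0 < expectation (\<lambda>\<omega>. h (g 1 \<omega>))"
  shows "\<exists>\<mu>>0. AE \<omega> in M. eventually (\<lambda>k. \<mu> * 2 ^ k \<le> (\<Sum>n\<in>dyadic_block k. h (g n \<omega>)) \<and>
      (\<Sum>n\<in>dyadic_block k. h (g n \<omega>)) \<le> 3 * \<mu> * 2 ^ k) sequentially"
proof (intro exI conjI)
  define \<mu> where "\<mu> = expectation (\<lambda>\<omega>. h (g 1 \<omega>))"
  show "0 < \<mu>" using pos by (simp add: \<mu>_def)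
  have mean: "expectation (\<lambda>\<omega>. h (g n \<omega>)) = \<mu>" if "n \<noteq> 0" for n
    unfolding \<mu>_def using gauss that by (intro standard_complex_gaussian_expectation_eq) auto
  have var: "variance (\<lambda>\<omega>. h (g n \<omega>)) \<le> variance (\<lambda>\<omega>. h (g 1 \<omega>))" if "n \<noteq> 0" for n
  proof -
    have "expectation (\<lambda>\<omega>. (h (g n \<omega>) - \<mu>)\<^sup>2) = expectation (\<lambda>\<omega>. (h (g 1 \<omega>) - \<mu>)\<^sup>2)"
      using gauss that
      by (intro standard_complex_gaussian_expectation_eq[where h = "\<lambda>z. (h z - \<mu>)\<^sup>2"]) auto
    then show ?thesis using that by (simp add: mean)
  qed
  have "AE \<omega> in M. eventually (\<lambda>k. \<bar>(\<Sum>n\<in>dyadic_block k. h (g n \<omega>)) - 2 ^ Suc k * \<mu>\<bar> < 2 ^ Suc k * (\<mu> / 2)) sequentially"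
    by (rule AE_dyadic_block_average[where v = "variance (\<lambda>\<omega>. h (g 1 \<omega>))"])
       (use int mean var \<open>0 < \<mu>\<close> indep in \<open>auto intro: indep_vars_compose2[where Y = "\<lambda>_. h" and X = g]\<close>)
  then show "AE \<omega> in M. eventually (\<lambda>k. \<mu> * 2 ^ k \<le> (\<Sum>n\<in>dyadic_block k. h (g n \<omega>)) \<and>
      (\<Sum>n\<in>dyadic_block k. h (g n \<omega>)) \<le> 3 * \<mu> * 2 ^ k) sequentially"
  proof eventually_elim
    case (elim \<omega>)
    then show ?case
    proof eventually_elim
      case (elim k)
      have "0 < \<mu> * 2 ^ k" using \<open>0 < \<mu>\<close> by simp
      with elim show ?case unfolding power_Suc by (simp add: abs_less_iff mult_ac)
    qed
  qed
qed

lemma AE_gaussian_moment_dyadic_block: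
  assumes indep: "indep_vars (\<lambda>_. borel) g {n. n \<noteq> (0::int)}"
    and gauss: "\<And>n. n \<noteq> 0 \<Longrightarrow> standard_complex_gaussian M (g n)"
    and "0 \<le> r"
  shows "\<exists>\<mu>>0. AE \<omega> in M. eventually (\<lambda>k. \<mu> * 2 ^ k \<le> (\<Sum>n\<in>dyadic_block k. cmod (g n \<omega>) powr r) \<and>
      (\<Sum>n\<in>dyadic_block k. cmod (g n \<omega>) powr r) \<le> 3 * \<mu> * 2 ^ k) sequentially"
proof (rule AE_gaussian_dyadic_block_average[OF indep gauss, where h = "\<lambda>z. cmod z powr r"])
  fix n :: int assume n: "n \<noteq> 0"
  show "integrable M (\<lambda>\<omega>. cmod (g n \<omega>) powr r)"
    using assms n by (intro standard_complex_gaussian_moment) auto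
  have "(cmod z powr r)\<^sup>2 = cmod z powr (2 * r)" for z
    by (simp add: power2_eq_square flip: powr_add)
  then show "integrable M (\<lambda>\<omega>. (cmod (g n \<omega>) powr r)\<^sup>2)"
    using assms n by (simp add: standard_complex_gaussian_moment)
next
  show "0 < expectation (\<lambda>\<omega>. cmod (g 1 \<omega>) powr r)"
    using assms by (intro standard_complex_gaussian_moment_pos) auto
qed auto

text \<open>With \<open>h\<close> the indicator of \<open>|z| > K\<close>, the block average counts the large coefficients, and
  their number is eventually a positive proportion of the block.\<close>
lemma AE_gaussian_large_in_dyadic_block:
  assumes indep: "indep_vars (\<lambda>_. borel) g {n. n \<noteq> (0::int)}"
    and gauss: "\<And>n. n \<noteq> 0 \<Longrightarrow> standard_complex_gaussian M (g n)"
  shows "AE \<omega> in M. \<forall>K::nat. eventually (\<lambda>k. \<exists>n\<in>dyadic_block k. real K < cmod (g n \<omega>)) sequentially"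
  unfolding AE_all_countable
proof
  fix K :: nat
  define h :: "complex \<Rightarrow> real" where "h = indicator {z. real K < cmod z}"
  have h: "h \<in> borel_measurable borel" unfolding h_def by measurable
  have "\<exists>\<mu>>0. AE \<omega> in M. eventually (\<lambda>k. \<mu> * 2 ^ k \<le> (\<Sum>n\<in>dyadic_block k. h (g n \<omega>)) \<and>
      (\<Sum>n\<in>dyadic_block k. h (g n \<omega>)) \<le> 3 * \<mu> * 2 ^ k) sequentially"
  proof (rule AE_gaussian_dyadic_block_average[OF indep gauss h])
    fix n :: int assume "n \<noteq> 0"
    then have [measurable]: "g n \<in> borel_measurable M"
      using standard_complex_gaussian_measurable gauss by blast
    show "integrable M (\<lambda>\<omega>. h (g n \<omega>))"
      by (rule integrable_const_bound[where B = 1]) (use h in \<open>auto simp: h_def indicator_def\<close>)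
    show "integrable M (\<lambda>\<omega>. (h (g n \<omega>))\<^sup>2)"
      by (rule integrable_const_bound[where B = 1]) (use h in \<open>auto simp: h_def indicator_def\<close>)
  next
    have [measurable]: "g 1 \<in> borel_measurable M"
      using standard_complex_gaussian_measurable[OF gauss[of 1]] by simp
    have "expectation (\<lambda>\<omega>. h (g 1 \<omega>)) = expectation (indicator {\<omega> \<in> space M. real K < cmod (g 1 \<omega>)})"
      by (intro Bochner_Integration.integral_cong) (auto simp: h_def indicator_def)
    then show "0 < expectation (\<lambda>\<omega>. h (g 1 \<omega>))"
      using standard_complex_gaussian_tail_pos[OF gauss[of 1], of K] by simp
  qed
  then obtain \<mu> where \<mu>: "0 < \<mu>" and
    ev: "AE \<omega> in M. eventually (\<lambda>k. \<mu> * 2 ^ k \<le> (\<Sum>n\<in>dyadic_block k. h (g n \<omega>)) \<and>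
      (\<Sum>n\<in>dyadic_block k. h (g n \<omega>)) \<le> 3 * \<mu> * 2 ^ k) sequentially"
    by blast
  from ev show "AE \<omega> in M. eventually (\<lambda>k. \<exists>n\<in>dyadic_block k. real K < cmod (g n \<omega>)) sequentially"
  proof eventually_elim
    case (elim \<omega>)
    then show ?case
    proof eventually_elim
      case (elim k)
      show ?case
      proof (rule ccontr)
        assume "\<not> (\<exists>n\<in>dyadic_block k. real K < cmod (g n \<omega>))"
        then have "(\<Sum>n\<in>dyadic_block k. h (g n \<omega>)) = 0"
          by (intro sum.neutral) (auto simp: h_def)
        moreover have "0 < \<mu> * 2 ^ k" using \<mu> by simp
        ultimately show False using elim by simp
      qed
    qed
  qed
qed

end

section \<open>Mixed norms of the random coefficients\<close>

text \<open>Both \<open>\<langle>n\<rangle> / |n|\<close> and \<open>|n| / 2\<^sup>k\<close> lie between \<open>1\<close> and \<open>2\<close> on the block, which accounts for the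
  two summands in the exponent of \<open>L\<close>.\<close>
lemma weighted_modulus_dyadic_block:
  fixes s :: real and G :: "int \<Rightarrow> complex"
  assumes n: "n \<in> dyadic_block k"
  defines "w \<equiv> weighted_modulus s (\<lambda>n. G n / of_int n)" and "L \<equiv> 2 powr (\<bar>s\<bar> + \<bar>s - 1\<bar>)"
  shows "w n \<le> L * 2 powr (real k * (s - 1)) * cmod (G n)"
    and "2 powr (real k * (s - 1)) * cmod (G n) \<le> L * w n"
proof -
  define N where "N = \<bar>real_of_int n\<bar>"
  have "real_of_int (2 ^ k) \<le> real_of_int \<bar>n\<bar>" "real_of_int \<bar>n\<bar> \<le> real_of_int (2 ^ Suc k)"
    using n unfolding of_int_le_iff dyadic_block_def by auto
  then have N: "2 ^ k \<le> N" "N \<le> 2 * 2 ^ k" by (simp_all add: N_def)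
  have "(1::real) \<le> 2 ^ k" by simp
  with N(1) have "1 \<le> N" by linarith
  have jb: "N \<le> japanese_bracket n" "japanese_bracket n \<le> 2 * N" "0 < japanese_bracket n"
    using japanese_bracket_ge[of n] japanese_bracket_le[of n] \<open>1 \<le> N\<close> by (simp_all add: N_def)
  have pow: "(2 ^ k) powr (s - 1) = 2 powr (real k * (s - 1))"
    by (simp add: powr_powr flip: powr_realpow)
  have w: "w n = japanese_bracket n powr s * cmod (G n) / N"
    by (simp add: w_def weighted_modulus_def norm_divide N_def)
  have Ns: "N powr s / N = N powr (s - 1)"
    using \<open>1 \<le> N\<close> by (simp add: powr_diff)
  have L: "L = 2 powr \<bar>s\<bar> * 2 powr \<bar>s - 1\<bar>" by (simp add: L_def powr_add)
  have "japanese_bracket n powr s / N \<le> 2 powr \<bar>s\<bar> * N powr s / N"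
    using jb \<open>1 \<le> N\<close> by (intro divide_right_mono powr_le_powr_of_comparable) auto
  also have "\<dots> = 2 powr \<bar>s\<bar> * N powr (s - 1)" by (simp flip: Ns)
  also have "\<dots> \<le> 2 powr \<bar>s\<bar> * (2 powr \<bar>s - 1\<bar> * (2 ^ k) powr (s - 1))"
    using N \<open>1 \<le> N\<close> by (intro mult_left_mono powr_le_powr_of_comparable) auto
  finally have "japanese_bracket n powr s / N \<le> L * 2 powr (real k * (s - 1))"
    by (simp add: L pow)
  from mult_right_mono[OF this, of "cmod (G n)"]
  show "w n \<le> L * 2 powr (real k * (s - 1)) * cmod (G n)" by (simp add: w)
  have "(2 ^ k) powr (s - 1) \<le> 2 powr \<bar>s - 1\<bar> * N powr (s - 1)"
    using N \<open>1 \<le> N\<close> by (intro powr_le_powr_of_comparable) auto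
  also have "\<dots> = 2 powr \<bar>s - 1\<bar> * (N powr s / N)" by (simp add: Ns)
  also have "\<dots> \<le> 2 powr \<bar>s - 1\<bar> * (2 powr \<bar>s\<bar> * japanese_bracket n powr s / N)"
    using jb \<open>1 \<le> N\<close> by (intro mult_left_mono divide_right_mono powr_le_powr_of_comparable) auto
  finally have "2 powr (real k * (s - 1)) \<le> L * (japanese_bracket n powr s / N)"
    by (simp add: L pow mult_ac)
  from mult_right_mono[OF this, of "cmod (G n)"]
  show "2 powr (real k * (s - 1)) * cmod (G n) \<le> L * w n" by (simp add: w)
qed

text \<open>The weight contributes \<open>2\<^sup>k\<^sup>(\<^sup>s\<^sup>-\<^sup>1\<^sup>)\<close> and the sum over the block, raised to the power \<open>1 / r\<close>,
  contributes \<open>2\<^sup>k\<^sup>/\<^sup>r\<close>.\<close>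
lemma block_norm_comparable:
  fixes s r \<mu> :: real and G :: "int \<Rightarrow> complex"
  assumes "1 \<le> r" "0 < \<mu>"
    and ev: "eventually (\<lambda>k. \<mu> * 2 ^ k \<le> (\<Sum>n\<in>dyadic_block k. cmod (G n) powr r) \<and>
        (\<Sum>n\<in>dyadic_block k. cmod (G n) powr r) \<le> 3 * \<mu> * 2 ^ k) sequentially"
  defines "w \<equiv> weighted_modulus s (\<lambda>n. G n / of_int n)"
  obtains C where "0 \<le> C"
    and "eventually (\<lambda>k. block_norm (ennreal r) w k \<le> ennreal C * ennreal (2 powr (real k * (s - 1 + 1 / r)))) sequentially"
    and "eventually (\<lambda>k. ennreal (2 powr (real k * (s - 1 + 1 / r))) \<le> ennreal C * block_norm (ennreal r) w k) sequentially"
proof -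
  define L where "L = 2 powr (\<bar>s\<bar> + \<bar>s - 1\<bar>)"
  have "0 < L" by (simp add: L_def)
  note w_le = weighted_modulus_dyadic_block[of _ _ s G, folded w_def L_def]
  have w_nonneg: "0 \<le> w n" for n by (simp add: w_def)
  define S where "S k = (\<Sum>n\<in>dyadic_block k. cmod (G n) powr r)" for k
  define W where "W k = (\<Sum>n\<in>dyadic_block k. w n powr r)" for k
  have SW: "0 \<le> S k" "0 \<le> W k" for k by (simp_all add: S_def W_def sum_nonneg)
  define a where "a k = 2 powr (real k * (s - 1))" for k
  have a: "0 < a k" for k by (simp add: a_def)
  have norm: "block_norm (ennreal r) w k = ennreal (W k powr (1 / r))" for k
    using assms w_nonneg by (simp add: block_norm_ennreal W_def)
  have upper: "W k powr (1 / r) \<le> L * a k * S k powr (1 / r)" for k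
  proof -
    have "W k \<le> (\<Sum>n\<in>dyadic_block k. (L * a k * cmod (G n)) powr r)"
      unfolding W_def a_def using w_le(1) w_nonneg assms(1) by (intro sum_mono powr_mono2) auto
    also have "\<dots> = (L * a k) powr r * S k"
      using \<open>0 < L\<close> a[of k] by (simp add: S_def sum_distrib_left powr_mult)
    finally have "W k powr (1 / r) \<le> ((L * a k) powr r * S k) powr (1 / r)"
      using SW assms(1) by (intro powr_mono2) auto
    also have "\<dots> = L * a k * S k powr (1 / r)"
      using \<open>0 < L\<close> a[of k] SW[of k] assms(1) by (simp add: powr_mult powr_powr)
    finally show ?thesis .
  qed
  have lower: "a k * S k powr (1 / r) \<le> L * W k powr (1 / r)" for k
  proof -
    have "a k powr r * S k = (\<Sum>n\<in>dyadic_block k. (a k * cmod (G n)) powr r)"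
      using a[of k] by (simp add: S_def sum_distrib_left powr_mult)
    also have "\<dots> \<le> (\<Sum>n\<in>dyadic_block k. (L * w n) powr r)"
      unfolding a_def using w_le(2) assms(1) by (intro sum_mono powr_mono2) auto
    also have "\<dots> = L powr r * W k"
      using \<open>0 < L\<close> w_nonneg by (simp add: W_def sum_distrib_left powr_mult)
    finally have "(a k powr r * S k) powr (1 / r) \<le> (L powr r * W k) powr (1 / r)"
      using SW assms(1) a[of k] by (intro powr_mono2) auto
    then show ?thesis
      using \<open>0 < L\<close> a[of k] SW[of k] assms(1) by (simp add: powr_mult powr_powr)
  qed
  have pow: "a k * (2 ^ k) powr (1 / r) = 2 powr (real k * (s - 1 + 1 / r))" for k
    by (simp add: a_def powr_powr distrib_left powr_add flip: powr_realpow)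
  define c where "c = (3 * \<mu>) powr (1 / r)"
  define d where "d = \<mu> powr (1 / r)"
  have cd: "0 < c" "0 < d" using assms by (simp_all add: c_def d_def)
  define C where "C = max (L * c) (L / d)"
  have C: "L * c \<le> C" "L / d \<le> C" "0 \<le> C"
    using \<open>0 < L\<close> cd by (auto simp: C_def le_max_iff_disj)
  show thesis
  proof (rule that[OF C(3)])
    show "eventually (\<lambda>k. block_norm (ennreal r) w k \<le> ennreal C * ennreal (2 powr (real k * (s - 1 + 1 / r)))) sequentially"
      using ev
    proof eventually_elim
      case (elim k)
      have "S k powr (1 / r) \<le> (3 * \<mu> * 2 ^ k) powr (1 / r)"
        using elim SW[of k] assms(1) by (intro powr_mono2) (auto simp: S_def)
      also have "\<dots> = c * (2 ^ k) powr (1 / r)"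
        using assms(2) by (simp add: c_def powr_mult)
      finally have "L * a k * S k powr (1 / r) \<le> L * a k * (c * (2 ^ k) powr (1 / r))"
        using \<open>0 < L\<close> a[of k] by (intro mult_left_mono) auto
      also have "\<dots> = (L * c) * 2 powr (real k * (s - 1 + 1 / r))"
        by (simp flip: pow)
      also have "\<dots> \<le> C * 2 powr (real k * (s - 1 + 1 / r))"
        using C by (intro mult_right_mono) auto
      finally show ?case
        using upper[of k] C by (simp add: norm flip: ennreal_mult)
    qed
    show "eventually (\<lambda>k. ennreal (2 powr (real k * (s - 1 + 1 / r))) \<le> ennreal C * block_norm (ennreal r) w k) sequentially"
      using ev
    proof eventually_elim
      case (elim k)
      have "d * (2 ^ k) powr (1 / r) = (\<mu> * 2 ^ k) powr (1 / r)"
        using assms(2) by (simp add: d_def powr_mult)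
      also have "\<dots> \<le> S k powr (1 / r)"
        using elim assms by (intro powr_mono2) (auto simp: S_def)
      finally have "a k * (d * (2 ^ k) powr (1 / r)) \<le> a k * S k powr (1 / r)"
        using a[of k] by (intro mult_left_mono) auto
      also have "\<dots> \<le> L * W k powr (1 / r)" by (rule lower)
      finally have "2 powr (real k * (s - 1 + 1 / r)) * d \<le> L * W k powr (1 / r)"
        by (simp add: mult_ac flip: pow)
      then have "2 powr (real k * (s - 1 + 1 / r)) \<le> L / d * W k powr (1 / r)"
        using cd by (simp add: field_simps)
      also have "\<dots> \<le> C * W k powr (1 / r)"
        using C by (intro mult_right_mono) auto
      finally show ?case
        using C by (simp add: norm flip: ennreal_mult)
    qed
  qed
qed

lemma mixed_norm_less_top_iff:
  fixes s r \<mu> :: real and G :: "int \<Rightarrow> complex"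
  assumes "1 \<le> r" "0 < \<mu>" "1 \<le> q"
    and ev: "eventually (\<lambda>k. \<mu> * 2 ^ k \<le> (\<Sum>n\<in>dyadic_block k. cmod (G n) powr r) \<and>
        (\<Sum>n\<in>dyadic_block k. cmod (G n) powr r) \<le> 3 * \<mu> * 2 ^ k) sequentially"
  shows "lp_norm q (block_norm (ennreal r) (weighted_modulus s (\<lambda>n. G n / of_int n))) < \<top> \<longleftrightarrow>
    (if q = \<infinity> then (s - 1) * r \<le> -1 else (s - 1) * r < -1)"
proof -
  define w where "w = weighted_modulus s (\<lambda>n. G n / of_int n)"
  define t where "t k = ennreal (2 powr (real k * (s - 1 + 1 / r)))" for k :: nat
  obtain C where C: "0 \<le> C"
    "eventually (\<lambda>k. block_norm (ennreal r) w k \<le> ennreal C * t k) sequentially"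
    "eventually (\<lambda>k. t k \<le> ennreal C * block_norm (ennreal r) w k) sequentially"
    using block_norm_comparable[OF assms(1,2) ev] unfolding w_def t_def by blast
  have "lp_norm q (block_norm (ennreal r) w) < \<top> \<longleftrightarrow> lp_norm q t < \<top>"
  proof
    assume "lp_norm q (block_norm (ennreal r) w) < \<top>"
    then show "lp_norm q t < \<top>"
      using lp_norm_less_top_eventually_le[OF assms(3) _ _ C(1,3)] by (simp add: t_def[abs_def])
  next
    assume "lp_norm q t < \<top>"
    then show "lp_norm q (block_norm (ennreal r) w) < \<top>"
      using lp_norm_less_top_eventually_le[OF assms(3) _ _ C(1,2)] assms(1)
      by (simp add: block_norm_less_top)
  qed
  also have "\<dots> \<longleftrightarrow> (if q = \<infinity> then s - 1 + 1 / r \<le> 0 else s - 1 + 1 / r < 0)"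
    unfolding t_def by (rule lp_norm_geometric_less_top_iff) fact
  also have "s - 1 + 1 / r \<le> 0 \<longleftrightarrow> (s - 1) * r \<le> -1"
    using assms(1) by (simp add: field_simps)
  also have "s - 1 + 1 / r < 0 \<longleftrightarrow> (s - 1) * r < -1"
    using assms(1) by (simp add: field_simps)
  finally show ?thesis unfolding w_def .
qed

text \<open>For \<open>s \<ge> 1\<close> the weight does not decay, so unbounded Gaussians already make single blocks
  arbitrarily large; no summation over the blocks is involved.\<close>
lemma mixed_norm_top_eq_top:
  fixes G :: "int \<Rightarrow> complex"
  assumes "1 \<le> q" "1 \<le> s"
    and ev: "\<And>K::nat. eventually (\<lambda>k. \<exists>n\<in>dyadic_block k. real K < cmod (G n)) sequentially"
  shows "lp_norm q (block_norm \<infinity> (weighted_modulus s (\<lambda>n. G n / of_int n))) = \<top>"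
proof (rule ccontr)
  define w where "w = weighted_modulus s (\<lambda>n. G n / of_int n)"
  define L where "L = 2 powr (\<bar>s\<bar> + \<bar>s - 1\<bar>)"
  have "0 < L" by (simp add: L_def)
  assume "lp_norm q (block_norm \<infinity> (weighted_modulus s (\<lambda>n. G n / of_int n))) \<noteq> \<top>"
  then obtain B where B: "0 \<le> B" "lp_norm q (block_norm \<infinity> w) = ennreal B"
    unfolding w_def by (metis ennreal_cases infinity_ennreal_def)
  define K where "K = nat \<lceil>L * B\<rceil>"
  obtain k n where n: "n \<in> dyadic_block k" "real K < cmod (G n)"
    using ev[of K] by (auto simp: eventually_sequentially)
  have "ennreal (w n) \<le> block_norm \<infinity> w k"
    using n by (intro le_block_norm) auto
  also have "\<dots> \<le> ennreal B"
    unfolding B(2)[symmetric] by (rule le_lp_norm) fact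
  finally have "w n \<le> B" using B by simp
  have "L * B \<le> real K" unfolding K_def by linarith
  also have "\<dots> < cmod (G n)" by fact
  also have "\<dots> \<le> 2 powr (real k * (s - 1)) * cmod (G n)"
    using assms(2) ge_one_powr_ge_zero[of 2 "real k * (s - 1)"]
    by (simp add: mult_le_cancel_right1)
  also have "\<dots> \<le> L * w n"
    using weighted_modulus_dyadic_block(2)[OF n(1), of s G] by (simp add: w_def L_def)
  also have "\<dots> \<le> L * B" using \<open>w n \<le> B\<close> \<open>0 < L\<close> by simp
  finally show False by simp
qed

definition mixed_norm_finite :: "ennreal \<Rightarrow> ennreal \<Rightarrow> real \<Rightarrow> bool" where
  "mixed_norm_finite p q s \<longleftrightarrow>
     (if p = \<infinity> then s < 1
      else if q = \<infinity> then (s - 1) * enn2real p \<le> -1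
      else (s - 1) * enn2real p < -1)"

lemma (in prob_space) AE_mixed_norm_less_top_iff:
  assumes indep: "indep_vars (\<lambda>_. borel) g {n. n \<noteq> (0::int)}"
    and gauss: "\<And>n. n \<noteq> 0 \<Longrightarrow> standard_complex_gaussian M (g n)"
    and "1 \<le> p" "1 \<le> q"
  shows "AE \<omega> in M. lp_norm q (block_norm p (weighted_modulus s (\<lambda>n. g n \<omega> / of_int n))) < \<top> \<longleftrightarrow>
    mixed_norm_finite p q s"
proof -
  have finite_exponent: "AE \<omega> in M. lp_norm q (block_norm (ennreal r) (weighted_modulus s (\<lambda>n. g n \<omega> / of_int n))) < \<top> \<longleftrightarrow>
      (if q = \<infinity> then (s - 1) * r \<le> -1 else (s - 1) * r < -1)" if r: "1 \<le> r" for r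
  proof -
    obtain \<mu> where \<mu>: "0 < \<mu>" and ev: "AE \<omega> in M. eventually (\<lambda>k. \<mu> * 2 ^ k \<le> (\<Sum>n\<in>dyadic_block k. cmod (g n \<omega>) powr r) \<and>
      (\<Sum>n\<in>dyadic_block k. cmod (g n \<omega>) powr r) \<le> 3 * \<mu> * 2 ^ k) sequentially"
      using AE_gaussian_moment_dyadic_block[OF indep gauss, of r] r by auto
    from ev show ?thesis
      by eventually_elim (rule mixed_norm_less_top_iff[OF r \<mu> assms(4)])
  qed
  show ?thesis
    using \<open>1 \<le> p\<close>
  proof (cases p rule: exponent_cases)
    case (real r)
    then show ?thesis
      using finite_exponent[OF real(1)] by (cases "q = \<infinity>") (simp_all add: mixed_norm_finite_def)
  next
    case top
    show ?thesis
    proof (cases "s < 1")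
      case True
      \<comment> \<open>A finite inner exponent at which the strict condition still holds: \<open>(s - 1) r = s - 2\<close>.\<close>
      define r where "r = 1 + 1 / (1 - s)"
      have "(s - 1) * r = s - 2" "1 \<le> r"
        using True by (simp_all add: r_def field_simps)
      then have r: "1 \<le> r" "(s - 1) * r < -1"
        using True by simp_all
      from finite_exponent[OF r(1)] show ?thesis
      proof eventually_elim
        case (elim \<omega>)
        define w where "w = weighted_modulus s (\<lambda>n. g n \<omega> / of_int n)"
        have "lp_norm q (block_norm \<infinity> w) \<le> lp_norm q (block_norm (ennreal r) w)"
          using r assms by (intro Lp_norm_mono block_norm_top_le) auto
        also have "\<dots> < \<top>" using elim r by (auto simp: w_def)
        finally show ?case using True by (simp add: top w_def mixed_norm_finite_def)
      qed
    next
      case False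
      have "AE \<omega> in M. \<forall>K::nat. eventually (\<lambda>k. \<exists>n\<in>dyadic_block k. real K < cmod (g n \<omega>)) sequentially"
        using indep gauss by (rule AE_gaussian_large_in_dyadic_block)
      then show ?thesis
      proof eventually_elim
        case (elim \<omega>)
        then have "lp_norm q (block_norm \<infinity> (weighted_modulus s (\<lambda>n. g n \<omega> / of_int n))) = \<top>"
          using False assms by (intro mixed_norm_top_eq_top) auto
        then show ?case using False by (simp add: top mixed_norm_finite_def)
      qed
    qed
  qed
qed

theorem theorem2p1:
  fixes M :: "'w measure"
    and g :: "int \<Rightarrow> 'w \<Rightarrow> complex"
    and u :: "'w \<Rightarrow> real \<Rightarrow> complex"
    and \<psi> :: "int \<Rightarrow> complex"
    and \<phi>\<^sub>0 \<phi> :: "real \<Rightarrow> complex"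
    and p q :: ennreal
    and s :: real
  assumes "prob_space M"
    and "prob_space.indep_vars M (\<lambda>_. borel) g {n. n \<noteq> 0}"
    and "\<And>n. n \<noteq> 0 \<Longrightarrow> standard_complex_gaussian M (g n)"
    and "AE \<omega> in M. sum_of_fourier_series (u \<omega>) (\<lambda>n. if n = 0 then 0 else g n \<omega> / of_int n)"
    and "modulation_window \<psi>"
    and "dyadic_partition \<phi>\<^sub>0 \<phi>"
    and "1 \<le> p" and "1 \<le> q"
  shows "(q < \<infinity> \<longrightarrow>
            ((s - 1) * enn2real q < -1 \<longrightarrow>
               (AE \<omega> in M. modulation_norm \<psi> p q s (fourier_coeff (u \<omega>)) < \<infinity>)) \<and>
            ((s - 1) * enn2real q \<ge> -1 \<longrightarrow>
               (AE \<omega> in M. \<not> modulation_norm \<psi> p q s (fourier_coeff (u \<omega>)) < \<infinity>)))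
       \<and> (q = \<infinity> \<longrightarrow>
            (s < 1 \<longrightarrow>
               (AE \<omega> in M. modulation_norm \<psi> p \<infinity> s (fourier_coeff (u \<omega>)) < \<infinity>)) \<and>
            (s \<ge> 1 \<longrightarrow>
               (AE \<omega> in M. \<not> modulation_norm \<psi> p \<infinity> s (fourier_coeff (u \<omega>)) < \<infinity>)))
       \<and> (q < \<infinity> \<longrightarrow>
            ((if p = \<infinity> then s < 1 else (s - 1) * enn2real p < -1) \<longrightarrow>
               (AE \<omega> in M. fourier_besov_norm \<phi>\<^sub>0 \<phi> p q s (fourier_coeff (u \<omega>)) < \<infinity>)) \<and>
            ((if p = \<infinity> then s \<ge> 1 else (s - 1) * enn2real p \<ge> -1) \<longrightarrow>
               (AE \<omega> in M. \<not> fourier_besov_norm \<phi>\<^sub>0 \<phi> p q s (fourier_coeff (u \<omega>)) < \<infinity>)))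
       \<and> (q = \<infinity> \<and> p < \<infinity> \<longrightarrow>
            ((s - 1) * enn2real p \<le> -1 \<longrightarrow>
               (AE \<omega> in M. fourier_besov_norm \<phi>\<^sub>0 \<phi> p \<infinity> s (fourier_coeff (u \<omega>)) < \<infinity>)) \<and>
            ((s - 1) * enn2real p > -1 \<longrightarrow>
               (AE \<omega> in M. \<not> fourier_besov_norm \<phi>\<^sub>0 \<phi> p \<infinity> s (fourier_coeff (u \<omega>)) < \<infinity>)))"
proof -
  interpret prob_space M by fact
  have coeff: "AE \<omega> in M. fourier_coeff (u \<omega>) = (\<lambda>n. g n \<omega> / of_int n)"
    using assms(4)
  proof eventually_elim
    case (elim \<omega>)
    from fourier_coeff_sum_of_fourier_series[OF elim] show ?case
      by (auto simp: fun_eq_iff)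
  qed
  have mixed: "AE \<omega> in M. lp_norm q (block_norm r (weighted_modulus s (\<lambda>n. g n \<omega> / of_int n))) < \<top> \<longleftrightarrow>
      mixed_norm_finite r q s" if "1 \<le> r" for r
    using assms(2,3) that \<open>1 \<le> q\<close> by (rule AE_mixed_norm_less_top_iff)
  \<comment> \<open>The modulation norm does not depend on \<open>p\<close>: it is the mixed norm with both exponents \<open>q\<close>.\<close>
  have modulation: "AE \<omega> in M. modulation_norm \<psi> p q s (fourier_coeff (u \<omega>)) < \<infinity> \<longleftrightarrow> mixed_norm_finite q q s"
    using coeff mixed[OF \<open>1 \<le> q\<close>]
  proof eventually_elim
    case (elim \<omega>)
    then show ?case
      using modulation_norm_less_top_iff[OF assms(5,7,8), of s "fourier_coeff (u \<omega>)"]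
        lp_norm_less_top_iff_block_norm[OF \<open>1 \<le> q\<close>, of "weighted_modulus s (fourier_coeff (u \<omega>))"]
      by (simp add: weighted_modulus_def)
  qed
  have besov: "AE \<omega> in M. fourier_besov_norm \<phi>\<^sub>0 \<phi> p q s (fourier_coeff (u \<omega>)) < \<infinity> \<longleftrightarrow> mixed_norm_finite p q s"
    using coeff mixed[OF \<open>1 \<le> p\<close>]
  proof eventually_elim
    case (elim \<omega>)
    then show ?case
      using fourier_besov_norm_less_top_iff[OF assms(6,7,8), of "fourier_coeff (u \<omega>)" s] by simp
  qed
  have AE_imp: "AE \<omega> in M. A \<omega>" if "AE \<omega> in M. A \<omega> \<longleftrightarrow> P" P for A P
    using that by auto
  have AE_not: "AE \<omega> in M. \<not> A \<omega>" if "AE \<omega> in M. A \<omega> \<longleftrightarrow> P" "\<not> P" for A P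
    using that by auto
  note mod = AE_imp[OF modulation] AE_not[OF modulation]
  note bes = AE_imp[OF besov] AE_not[OF besov]
  show ?thesis
    using mod bes unfolding mixed_norm_finite_def
    by (cases "q = \<infinity>"; cases "p = \<infinity>") (simp_all add: not_less not_le less_top[symmetric])
qed

end
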